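(* Let $\mathcal{A}=(L,E,R,\partial_1,\partial_2,\{,\})$ and $\mathcal{A}'=(L',E',R',\partial_1',\partial_2',\{,\})$ be 2-crossed modules of commutative algebras. Suppose that $\mathcal{A}$ is free up to order one, with a chosen free basis $B$ of $R$. Then there is a groupoid $\mathrm{HOM}(\mathcal{A},\mathcal{A}')$ whose objects are the 2-crossed module maps $\mathcal{A}\to\mathcal{A}'$ and whose morphisms $f\to g$ are the homotopies $(f,s,t)$ connecting $f$ to $g$. The groupoid operations are the concatenations and inverses of homotopies: the composite of $f\xrightarrow{(f,s,t)}g$ and $g\xrightarrow{(g,s',t')}h$ is $f\xrightarrow{(f,\,s\boxplus s',\,t\boxplus t')}h$, the identity of $f$ is $(f,0,0)$, and the inverse of $f\xrightarrow{(f,s,t)}g$ is $g\xrightarrow{(g,\bar s,\bar t)}f$.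
   Context: Conventions. $\kappa$ is a fixed commutative ring. All algebras are commutative $\kappa$-algebras, and algebra maps are homomorphisms of $\kappa$-algebras. An action of an algebra $R$ on an algebra $M$ is a $\kappa$-bilinear map $(r,m)\mapsto r\blacktriangleright m\in M$ with $r\blacktriangleright(mm')=(r\blacktriangleright m)m'=m(r\blacktriangleright m')$ and $(rr')\blacktriangleright m=r\blacktriangleright(r'\blacktriangleright m)$. Given such an action, $R\ltimes_{\blacktriangleright}M$ is the algebra of pairs $(r,m)$ with product $(r,m)(r',m')=(rr',\,r\blacktriangleright m'+r'\blacktriangleright m+mm')$. 2-crossed modules. A 2-crossed module $(L,E,R,\partial_1,\partial_2,\{,\})$ consists of algebra maps $L\xrightarrow{\partial_2}E\xrightarrow{\partial_1}R$ with $\partial_1\partial_2=0$, actions $\blacktriangleright$ of $R$ on $E$ and on $L$ with $\partial_1(r\blacktriangleright e)=r\,\partial_1(e)$ and $\partial_2(r\blacktriangleright l)=r\blacktriangleright\partial_2(l)$, and an $R$-bilinear Peiffer lifting $\{\,\otimes\,\}\colon E\otimes_R E\to L$ such that, writing $e\blacktriangleright' l:=\{e\otimes\partial_2(l)\}$ (this is an action of $E$ on $L$), for all $e,e',e''\in E$, $l,l'\in L$, $r\in R$: $\partial_2\{e\otimes e'\}=ee'-\partial_1(e')\blacktriangleright e$; $\{\partial_2(l)\otimes\partial_2(l')\}=ll'$; $\{e\otimes e'e''\}=\{ee'\otimes e''\}+\partial_1(e'')\blacktriangleright\{e\otimes e'\}$; $\{\partial_2(l)\otimes e\}=e\blacktriangleright'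 l-\partial_1(e)\blacktriangleright l$; $r\blacktriangleright\{e\otimes e'\}=\{r\blacktriangleright e\otimes e'\}=\{e\otimes r\blacktriangleright e'\}$. Freeness. The 2-crossed module is free up to order one if $R$ is a free $\kappa$-algebra; it then comes equipped with a specified free algebra basis $B$ of $R$, so that $R$ is the algebra of polynomials over $\kappa$ with a formal variable assigned to each element of $B$. Maps. A 2-crossed module map $f=(f_2,f_1,f_0)\colon\mathcal{A}\to\mathcal{A}'$ consists of algebra maps $f_2\colon L\to L'$, $f_1\colon E\to E'$, $f_0\colon R\to R'$ with $\partial_2'f_2=f_1\partial_2$, $\partial_1'f_1=f_0\partial_1$, $f_1(r\blacktriangleright e)=f_0(r)\blacktriangleright f_1(e)$, $f_2(r\blacktriangleright l)=f_0(r)\blacktriangleright f_2(l)$, $f_2\{e\otimes e'\}=\{f_1(e)\otimes f_1(e')\}$. Homotopies. For an algebra map $f_0\colon R\to R'$, an $f_0$-derivation is a $\kappa$-linear map $s\colon R\to E'$ with $s(rr')=f_0(r)\blacktriangleright s(r')+f_0(r')\blacktriangleright s(r)+s(r)s(r')$. For a 2-crossed module map $f$, a quadratic $f$-derivation is a pair $(s,t)$ where $s\colon R\to E'$ is an $f_0$-derivation and $t\colon E\to L'$ is $\kappa$-linear with, for all $e,e'\in E$, $r\in R$: $t(ee')=\{s\partial_1(e)\otimes f_1(e')\}+\{s\partial_1(e')\otimes f_1(e)\}+f_1(e)\blacktriangleright' t(e')+f_1(e')\blacktriangleright' t(e)+s\partial_1(e)\blacktriangleright' t(e')+s\partial_1(e')\blacktriangleright'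 t(e)+t(e)t(e')$, $t(r\blacktriangleright e)=f_0(r)\blacktriangleright t(e)+\partial_1's(r)\blacktriangleright t(e)+\{s(r)\otimes f_1(e)\}-\{f_1(e)\otimes s(r)\}-\{s\partial_1(e)\otimes s(r)\}$. A homotopy $(f,s,t)$ connecting $f$ to $g$, written $f\xrightarrow{(f,s,t)}g$, is a quadratic $f$-derivation $(s,t)$ with $g_0=f_0+\partial_1's$, $g_1=f_1+s\partial_1+\partial_2't$, $g_2=f_2+t\partial_2$. Operations. Since $R$ is free on $B$, a set map from $B$ to an algebra extends uniquely to an algebra map from $R$; and since $f_0$-derivations $s$ correspond to algebra maps $r\mapsto(f_0(r),s(r))\in R'\ltimes_{\blacktriangleright}E'$, a set map $B\to E'$ extends uniquely to an $f_0$-derivation $R\to E'$. The algebra of 2-simplices of $\mathcal{A}'$ is $\mathcal{A}'_2=(R'\ltimes_{\blacktriangleright}E')\ltimes_{\blacktriangleright_\bullet}(E'\ltimes_{\blacktriangleright'}L')$, where $(r,e)\blacktriangleright_\bullet(e',l)=(ee'+r\blacktriangleright e',\ \partial_1'(e)\blacktriangleright l+r\blacktriangleright l-\{e'\otimes e\})$. For an $f_0$-derivation $s$, the algebra map $g_0=f_0+\partial_1's$, and a $g_0$-derivation $s'$, let $X^{(s,s')}\colon R\to\mathcal{A}'_2$ be the unique algebra map with $X^{(s,s')}(b)=(f_0(b),s(b),s'(b),0)$ for $b\in B$, and let $w^{(s,s')}\colon R\to L'$ be its $L'$-component. Let $s\boxplus s'$ be the unique $f_0$-derivation with $(s\boxplus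 s')(b)=s(b)+s'(b)$ for $b\in B$. For homotopies $f\xrightarrow{(f,s,t)}g\xrightarrow{(g,s',t')}h$ put $t\boxplus t'=t+t'+w^{(s,s')}\circ\partial_1$. For a homotopy $f\xrightarrow{(f,s,t)}g$ let $\bar s\colon R\to E'$ be the unique $g_0$-derivation with $\bar s(b)=-s(b)$ for $b\in B$, and $\bar t=-t-w^{(s,\bar s)}\circ\partial_1$. *)

theory Defs
  imports Main "HOL-Library.Multiset" "HOL-Library.Product_Plus" "HOL-Library.Poly_Mapping"
begin

(* The ground ring has sort {comm_ring, comm_monoid_mult} rather than comm_ring_1, because
   comm_ring_1 (hence also the library locale module) excludes the zero ring.

   Algebras are not assumed to have an identity: the condition d1 d2 = 0 on a 2-crossed module
   rules out identity-preserving boundary maps.  Every algebra is carried by a type of class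
   comm_ring, so that maps are determined by their values.

   For the base algebra R two conventions are in use, and the flag called unital selects one:
   - False: R is not assumed to have an identity, and the free algebra on B consists of the
     polynomials in B without constant term;
   - True: R has an identity, which acts as the identity on E and L and is preserved by algebra
     maps out of R, and the free algebra on B is the full polynomial algebra.
   In both cases a set map on B extends uniquely to an algebra map out of the free algebra
   (in the second case, into algebras with an identity). *)

definition comm_alg :: "('k::{comm_ring,comm_monoid_mult} \<Rightarrow> 'a::comm_ring \<Rightarrow> 'a) \<Rightarrow> bool" where
  "comm_alg sc \<longleftrightarrow>
     (\<forall>c x y. sc c (x + y) = sc c x + sc c y) \<and>
     (\<forall>c d x. sc (c + d) x = sc c x + sc d x) \<and>
     (\<forall>c d x. sc (c * d) x = sc c (sc d x)) \<and>
     (\<forall>x. sc 1 x = x) \<and>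
     (\<forall>c x y. sc c (x * y) = sc c x * y)"

definition klinear ::
  "('k \<Rightarrow> 'a::ab_group_add \<Rightarrow> 'a) \<Rightarrow> ('k \<Rightarrow> 'b::ab_group_add \<Rightarrow> 'b) \<Rightarrow> ('a \<Rightarrow> 'b) \<Rightarrow> bool" where
  "klinear sa sb f \<longleftrightarrow> (\<forall>x y. f (x + y) = f x + f y) \<and> (\<forall>c x. f (sa c x) = sb c (f x))"

definition kbilinear ::
  "('k \<Rightarrow> 'a::ab_group_add \<Rightarrow> 'a) \<Rightarrow> ('k \<Rightarrow> 'b::ab_group_add \<Rightarrow> 'b) \<Rightarrow>
   ('k \<Rightarrow> 'c::ab_group_add \<Rightarrow> 'c) \<Rightarrow> ('a \<Rightarrow> 'b \<Rightarrow> 'c) \<Rightarrow> bool" where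
  "kbilinear sa sb sc h \<longleftrightarrow> (\<forall>x. klinear sb sc (h x)) \<and> (\<forall>y. klinear sa sc (\<lambda>x. h x y))"

definition is_identity :: "('a \<Rightarrow> 'a \<Rightarrow> 'a) \<Rightarrow> 'a \<Rightarrow> bool" where
  "is_identity mul u \<longleftrightarrow> (\<forall>x. mul u x = x)"

(* Products are explicit arguments because semidirect products carry several products on one
   product type. *)
definition alg_map ::
  "('k \<Rightarrow> 'a::ab_group_add \<Rightarrow> 'a) \<Rightarrow> ('a \<Rightarrow> 'a \<Rightarrow> 'a) \<Rightarrow>
   ('k \<Rightarrow> 'b::ab_group_add \<Rightarrow> 'b) \<Rightarrow> ('b \<Rightarrow> 'b \<Rightarrow> 'b) \<Rightarrow> ('a \<Rightarrow> 'b) \<Rightarrow> bool" where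
  "alg_map sa ma sb mb f \<longleftrightarrow> klinear sa sb f \<and> (\<forall>x y. f (ma x y) = mb (f x) (f y))"

definition base_alg_map ::
  "bool \<Rightarrow> ('k \<Rightarrow> 'a::ab_group_add \<Rightarrow> 'a) \<Rightarrow> ('a \<Rightarrow> 'a \<Rightarrow> 'a) \<Rightarrow>
   ('k \<Rightarrow> 'b::ab_group_add \<Rightarrow> 'b) \<Rightarrow> ('b \<Rightarrow> 'b \<Rightarrow> 'b) \<Rightarrow> ('a \<Rightarrow> 'b) \<Rightarrow> bool" where
  "base_alg_map unital sa ma sb mb f \<longleftrightarrow>
     alg_map sa ma sb mb f \<and>
     (unital \<longrightarrow> (\<forall>u. is_identity ma u \<longrightarrow> is_identity mb (f u)))"

definition alg_action ::
  "('k \<Rightarrow> 'r::comm_ring \<Rightarrow> 'r) \<Rightarrow> ('k \<Rightarrow> 'm::comm_ring \<Rightarrow> 'm) \<Rightarrow> ('r \<Rightarrow> 'm \<Rightarrow> 'm) \<Rightarrow> bool" where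
  "alg_action sr sm act \<longleftrightarrow>
     kbilinear sr sm sm act \<and>
     (\<forall>r m m'. act r (m * m') = act r m * m' \<and> act r (m * m') = m * act r m') \<and>
     (\<forall>r r' m. act (r * r') m = act r (act r' m))"

definition semi_scale :: "('k \<Rightarrow> 'r \<Rightarrow> 'r) \<Rightarrow> ('k \<Rightarrow> 'm \<Rightarrow> 'm) \<Rightarrow> 'k \<Rightarrow> 'r \<times> 'm \<Rightarrow> 'r \<times> 'm" where
  "semi_scale sr sm c = map_prod (sr c) (sm c)"

definition semi_mult ::
  "('r \<Rightarrow> 'm \<Rightarrow> 'm) \<Rightarrow> ('r \<Rightarrow> 'r \<Rightarrow> 'r) \<Rightarrow> ('m::plus \<Rightarrow> 'm \<Rightarrow> 'm) \<Rightarrow>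
   'r \<times> 'm \<Rightarrow> 'r \<times> 'm \<Rightarrow> 'r \<times> 'm" where
  "semi_mult act mr mm = (\<lambda>(r, m) (r', m'). (mr r r', act r m' + act r' m + mm m m'))"

record ('k, 'l, 'e, 'r) xmod2 =
  scL :: "'k \<Rightarrow> 'l \<Rightarrow> 'l"
  scE :: "'k \<Rightarrow> 'e \<Rightarrow> 'e"
  scR :: "'k \<Rightarrow> 'r \<Rightarrow> 'r"
  bd2 :: "'l \<Rightarrow> 'e"
  bd1 :: "'e \<Rightarrow> 'r"
  actE :: "'r \<Rightarrow> 'e \<Rightarrow> 'e"
  actL :: "'r \<Rightarrow> 'l \<Rightarrow> 'l"
  plift :: "'e \<Rightarrow> 'e \<Rightarrow> 'l"

definition actP :: "('k, 'l, 'e, 'r) xmod2 \<Rightarrow> 'e \<Rightarrow> 'l \<Rightarrow> 'l" where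
  "actP A e l = plift A e (bd2 A l)"

(* The Peiffer lifting on the tensor product of E with itself over R is given as an R-bilinear
   map of two arguments.  That actP is an action of E on L follows from the axioms. *)
definition two_crossed_module ::
  "bool \<Rightarrow> ('k::{comm_ring,comm_monoid_mult}, 'l::comm_ring, 'e::comm_ring, 'r::comm_ring) xmod2 \<Rightarrow> bool"
where
  "two_crossed_module unital A \<longleftrightarrow>
     comm_alg (scL A) \<and> comm_alg (scE A) \<and> comm_alg (scR A) \<and>
     alg_map (scL A) (*) (scE A) (*) (bd2 A) \<and>
     alg_map (scE A) (*) (scR A) (*) (bd1 A) \<and>
     (\<forall>l. bd1 A (bd2 A l) = 0) \<and>
     alg_action (scR A) (scE A) (actE A) \<and>
     alg_action (scR A) (scL A) (actL A) \<and>
     (\<forall>r e. bd1 A (actE A r e) = r * bd1 A e) \<and>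
     (\<forall>r l. bd2 A (actL A r l) = actE A r (bd2 A l)) \<and>
     kbilinear (scE A) (scE A) (scL A) (plift A) \<and>
     (\<forall>e e'. bd2 A (plift A e e') = e * e' - actE A (bd1 A e') e) \<and>
     (\<forall>l l'. plift A (bd2 A l) (bd2 A l') = l * l') \<and>
     (\<forall>e e' e''. plift A e (e' * e'') = plift A (e * e') e'' + actL A (bd1 A e'') (plift A e e')) \<and>
     (\<forall>l e. plift A (bd2 A l) e = actP A e l - actL A (bd1 A e) l) \<and>
     (\<forall>r e e'. actL A r (plift A e e') = plift A (actE A r e) e' \<and>
               actL A r (plift A e e') = plift A e (actE A r e')) \<and>
     (unital \<longrightarrow> (\<exists>u. is_identity (*) u \<and> (\<forall>e. actE A u e = e) \<and> (\<forall>l. actL A u l = l)))"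

(* Products of nonempty multisets are formed without an identity (None is the empty product);
   the empty monomial denotes the identity and only occurs under the unital convention. *)
definition monomial :: "'a::comm_ring multiset \<Rightarrow> 'a" where
  "monomial m =
     (case fold_mset (\<lambda>b p. Some (case p of None \<Rightarrow> b | Some x \<Rightarrow> b * x)) None m of
        None \<Rightarrow> (THE u. is_identity (*) u)
      | Some x \<Rightarrow> x)"

(* B is a free basis iff evaluation of formal polynomials with variables in B is a bijection
   onto the algebra. *)
definition free_basis ::
  "bool \<Rightarrow> ('k::{comm_ring,comm_monoid_mult} \<Rightarrow> 'a::comm_ring \<Rightarrow> 'a) \<Rightarrow> 'a set \<Rightarrow> bool" where
  "free_basis unital sc B \<longleftrightarrow>
     bij_betw (\<lambda>p :: 'a multiset \<Rightarrow>\<^sub>0 'k. \<Sum>m\<in>Poly_Mapping.keys p. sc (Poly_Mapping.lookup p m) (monomial m))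
       {p. \<forall>m\<in>Poly_Mapping.keys p. set_mset m \<subseteq> B \<and> (unital \<or> m \<noteq> {#})} UNIV"

definition free_up_to_order_one ::
  "bool \<Rightarrow> ('k::{comm_ring,comm_monoid_mult}, 'l::comm_ring, 'e::comm_ring, 'r::comm_ring) xmod2 \<Rightarrow>
   'r set \<Rightarrow> bool" where
  "free_up_to_order_one unital A B \<longleftrightarrow> free_basis unital (scR A) B"

type_synonym ('l, 'e, 'r, 'l', 'e', 'r') xmap = "('l \<Rightarrow> 'l') \<times> ('e \<Rightarrow> 'e') \<times> ('r \<Rightarrow> 'r')"

definition xmod2_map ::
  "bool \<Rightarrow> ('k::{comm_ring,comm_monoid_mult}, 'l::comm_ring, 'e::comm_ring, 'r::comm_ring) xmod2 \<Rightarrow>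
   ('k, 'l'::comm_ring, 'e'::comm_ring, 'r'::comm_ring) xmod2 \<Rightarrow>
   ('l, 'e, 'r, 'l', 'e', 'r') xmap \<Rightarrow> bool" where
  "xmod2_map unital A A' = (\<lambda>(f2, f1, f0).
     alg_map (scL A) (*) (scL A') (*) f2 \<and>
     alg_map (scE A) (*) (scE A') (*) f1 \<and>
     base_alg_map unital (scR A) (*) (scR A') (*) f0 \<and>
     (\<forall>l. bd2 A' (f2 l) = f1 (bd2 A l)) \<and>
     (\<forall>e. bd1 A' (f1 e) = f0 (bd1 A e)) \<and>
     (\<forall>r e. f1 (actE A r e) = actE A' (f0 r) (f1 e)) \<and>
     (\<forall>r l. f2 (actL A r l) = actL A' (f0 r) (f2 l)) \<and>
     (\<forall>e e'. f2 (plift A e e') = plift A' (f1 e) (f1 e')))"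

(* Under the unital convention, derivations correspond to identity-preserving maps
   into the semidirect product, whose identity is (1, 0); hence the last clause. *)
definition derivation ::
  "bool \<Rightarrow> ('k::{comm_ring,comm_monoid_mult}, 'l::comm_ring, 'e::comm_ring, 'r::comm_ring) xmod2 \<Rightarrow>
   ('k, 'l'::comm_ring, 'e'::comm_ring, 'r'::comm_ring) xmod2 \<Rightarrow>
   ('r \<Rightarrow> 'r') \<Rightarrow> ('r \<Rightarrow> 'e') \<Rightarrow> bool" where
  "derivation unital A A' f0 s \<longleftrightarrow>
     klinear (scR A) (scE A') s \<and>
     (\<forall>r r'. s (r * r') = actE A' (f0 r) (s r') + actE A' (f0 r') (s r) + s r * s r') \<and>
     (unital \<longrightarrow> (\<forall>u. is_identity (*) u \<longrightarrow> s u = 0))"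

definition quadratic_derivation ::
  "bool \<Rightarrow> ('k::{comm_ring,comm_monoid_mult}, 'l::comm_ring, 'e::comm_ring, 'r::comm_ring) xmod2 \<Rightarrow>
   ('k, 'l'::comm_ring, 'e'::comm_ring, 'r'::comm_ring) xmod2 \<Rightarrow>
   ('l, 'e, 'r, 'l', 'e', 'r') xmap \<Rightarrow> ('r \<Rightarrow> 'e') \<Rightarrow> ('e \<Rightarrow> 'l') \<Rightarrow> bool" where
  "quadratic_derivation unital A A' = (\<lambda>(f2, f1, f0) s t.
     derivation unital A A' f0 s \<and>
     klinear (scE A) (scL A') t \<and>
     (\<forall>e e'. t (e * e') =
        plift A' (s (bd1 A e)) (f1 e') + plift A' (s (bd1 A e')) (f1 e)
        + actP A' (f1 e) (t e') + actP A' (f1 e') (t e)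
        + actP A' (s (bd1 A e)) (t e') + actP A' (s (bd1 A e')) (t e) + t e * t e') \<and>
     (\<forall>r e. t (actE A r e) =
        actL A' (f0 r) (t e) + actL A' (bd1 A' (s r)) (t e)
        + plift A' (s r) (f1 e) - plift A' (f1 e) (s r) - plift A' (s (bd1 A e)) (s r)))"

type_synonym ('l, 'e, 'r, 'l', 'e', 'r') hmtpy =
  "('l, 'e, 'r, 'l', 'e', 'r') xmap \<times> ('r \<Rightarrow> 'e') \<times> ('e \<Rightarrow> 'l')"

definition target ::
  "('k, 'l, 'e, 'r) xmod2 \<Rightarrow> ('k, 'l'::comm_ring, 'e'::comm_ring, 'r'::comm_ring) xmod2 \<Rightarrow>
   ('l, 'e, 'r, 'l', 'e', 'r') hmtpy \<Rightarrow> ('l, 'e, 'r, 'l', 'e', 'r') xmap" where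
  "target A A' = (\<lambda>((f2, f1, f0), s, t).
     ((\<lambda>l. f2 l + t (bd2 A l)),
      (\<lambda>e. f1 e + s (bd1 A e) + bd2 A' (t e)),
      (\<lambda>r. f0 r + bd1 A' (s r))))"

definition homotopies ::
  "bool \<Rightarrow> ('k::{comm_ring,comm_monoid_mult}, 'l::comm_ring, 'e::comm_ring, 'r::comm_ring) xmod2 \<Rightarrow>
   ('k, 'l'::comm_ring, 'e'::comm_ring, 'r'::comm_ring) xmod2 \<Rightarrow>
   ('l, 'e, 'r, 'l', 'e', 'r') xmap \<Rightarrow> ('l, 'e, 'r, 'l', 'e', 'r') xmap \<Rightarrow>
   ('l, 'e, 'r, 'l', 'e', 'r') hmtpy set" where
  "homotopies unital A A' f g =
     {(f, s, t) | s t. xmod2_map unital A A' f \<and> xmod2_map unital A A' g \<and>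
        quadratic_derivation unital A A' f s t \<and> g = target A A' (f, s, t)}"

definition simplex2_act ::
  "('k, 'l::comm_ring, 'e::comm_ring, 'r::comm_ring) xmod2 \<Rightarrow> 'r \<times> 'e \<Rightarrow> 'e \<times> 'l \<Rightarrow> 'e \<times> 'l" where
  "simplex2_act A = (\<lambda>(r, e) (e', l).
     (e * e' + actE A r e', actL A (bd1 A e) l + actL A r l - plift A e' e))"

definition simplex2_scale ::
  "('k, 'l, 'e, 'r) xmod2 \<Rightarrow> 'k \<Rightarrow> ('r \<times> 'e) \<times> ('e \<times> 'l) \<Rightarrow> ('r \<times> 'e) \<times> ('e \<times> 'l)" where
  "simplex2_scale A = semi_scale (semi_scale (scR A) (scE A)) (semi_scale (scE A) (scL A))"

definition simplex2_mult ::
  "('k, 'l::comm_ring, 'e::comm_ring, 'r::comm_ring) xmod2 \<Rightarrow>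
   ('r \<times> 'e) \<times> ('e \<times> 'l) \<Rightarrow> ('r \<times> 'e) \<times> ('e \<times> 'l) \<Rightarrow> ('r \<times> 'e) \<times> ('e \<times> 'l)" where
  "simplex2_mult A =
     semi_mult (simplex2_act A) (semi_mult (actE A) (*) (*)) (semi_mult (actP A) (*) (*))"

definition simplexX ::
  "bool \<Rightarrow> ('k::{comm_ring,comm_monoid_mult}, 'l::comm_ring, 'e::comm_ring, 'r::comm_ring) xmod2 \<Rightarrow>
   ('k, 'l'::comm_ring, 'e'::comm_ring, 'r'::comm_ring) xmod2 \<Rightarrow> 'r set \<Rightarrow>
   ('r \<Rightarrow> 'r') \<Rightarrow> ('r \<Rightarrow> 'e') \<Rightarrow> ('r \<Rightarrow> 'e') \<Rightarrow> 'r \<Rightarrow> ('r' \<times> 'e') \<times> ('e' \<times> 'l')" where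
  "simplexX unital A A' B f0 s s' =
     (THE X. base_alg_map unital (scR A) (*) (simplex2_scale A') (simplex2_mult A') X \<and>
             (\<forall>b\<in>B. X b = ((f0 b, s b), (s' b, 0))))"

definition simplexW ::
  "bool \<Rightarrow> ('k::{comm_ring,comm_monoid_mult}, 'l::comm_ring, 'e::comm_ring, 'r::comm_ring) xmod2 \<Rightarrow>
   ('k, 'l'::comm_ring, 'e'::comm_ring, 'r'::comm_ring) xmod2 \<Rightarrow> 'r set \<Rightarrow>
   ('r \<Rightarrow> 'r') \<Rightarrow> ('r \<Rightarrow> 'e') \<Rightarrow> ('r \<Rightarrow> 'e') \<Rightarrow> 'r \<Rightarrow> 'l'" where
  "simplexW unital A A' B f0 s s' r = snd (snd (simplexX unital A A' B f0 s s' r))"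

definition deriv_ext ::
  "bool \<Rightarrow> ('k::{comm_ring,comm_monoid_mult}, 'l::comm_ring, 'e::comm_ring, 'r::comm_ring) xmod2 \<Rightarrow>
   ('k, 'l'::comm_ring, 'e'::comm_ring, 'r'::comm_ring) xmod2 \<Rightarrow> 'r set \<Rightarrow>
   ('r \<Rightarrow> 'r') \<Rightarrow> ('r \<Rightarrow> 'e') \<Rightarrow> 'r \<Rightarrow> 'e'" where
  "deriv_ext unital A A' B f0 v = (THE d. derivation unital A A' f0 d \<and> (\<forall>b\<in>B. d b = v b))"

definition hconcat ::
  "bool \<Rightarrow> ('k::{comm_ring,comm_monoid_mult}, 'l::comm_ring, 'e::comm_ring, 'r::comm_ring) xmod2 \<Rightarrow>
   ('k, 'l'::comm_ring, 'e'::comm_ring, 'r'::comm_ring) xmod2 \<Rightarrow> 'r set \<Rightarrow>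
   ('l, 'e, 'r, 'l', 'e', 'r') hmtpy \<Rightarrow> ('l, 'e, 'r, 'l', 'e', 'r') hmtpy \<Rightarrow>
   ('l, 'e, 'r, 'l', 'e', 'r') hmtpy" where
  "hconcat unital A A' B = (\<lambda>((f2, f1, f0), s, t) (g, s', t').
     ((f2, f1, f0),
      deriv_ext unital A A' B f0 (\<lambda>b. s b + s' b),
      (\<lambda>e. t e + t' e + simplexW unital A A' B f0 s s' (bd1 A e))))"

definition hident ::
  "('l, 'e, 'r, 'l'::zero, 'e'::zero, 'r') xmap \<Rightarrow> ('l, 'e, 'r, 'l', 'e', 'r') hmtpy" where
  "hident f = (f, (\<lambda>_. 0), (\<lambda>_. 0))"

definition hinverse ::
  "bool \<Rightarrow> ('k::{comm_ring,comm_monoid_mult}, 'l::comm_ring, 'e::comm_ring, 'r::comm_ring) xmod2 \<Rightarrow>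
   ('k, 'l'::comm_ring, 'e'::comm_ring, 'r'::comm_ring) xmod2 \<Rightarrow> 'r set \<Rightarrow>
   ('l, 'e, 'r, 'l', 'e', 'r') hmtpy \<Rightarrow> ('l, 'e, 'r, 'l', 'e', 'r') hmtpy" where
  "hinverse unital A A' B = (\<lambda>((f2, f1, f0), s, t).
     let (g2, g1, g0) = target A A' ((f2, f1, f0), s, t);
         s_bar = deriv_ext unital A A' B g0 (\<lambda>b. - s b)
     in ((g2, g1, g0), s_bar, (\<lambda>e. - t e - simplexW unital A A' B f0 s s_bar (bd1 A e))))"

(* Composition is written in diagrammatic order. *)
locale groupoid =
  fixes Obj :: "'o set"
    and Hom :: "'o \<Rightarrow> 'o \<Rightarrow> 'm set"
    and comp :: "'m \<Rightarrow> 'm \<Rightarrow> 'm"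
    and ident :: "'o \<Rightarrow> 'm"
    and inver :: "'m \<Rightarrow> 'm"
  assumes hom_objects: "m \<in> Hom a b \<Longrightarrow> a \<in> Obj \<and> b \<in> Obj"
    and hom_disjoint: "m \<in> Hom a b \<Longrightarrow> m \<in> Hom a' b' \<Longrightarrow> a = a' \<and> b = b'"
    and comp_in_hom: "m \<in> Hom a b \<Longrightarrow> n \<in> Hom b c \<Longrightarrow> comp m n \<in> Hom a c"
    and ident_in_hom: "a \<in> Obj \<Longrightarrow> ident a \<in> Hom a a"
    and inver_in_hom: "m \<in> Hom a b \<Longrightarrow> inver m \<in> Hom b a"
    and comp_assoc: "m \<in> Hom a b \<Longrightarrow> n \<in> Hom b c \<Longrightarrow> p \<in> Hom c d \<Longrightarrow>
                       comp (comp m n) p = comp m (comp n p)"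
    and ident_comp: "m \<in> Hom a b \<Longrightarrow> comp (ident a) m = m"
    and comp_ident: "m \<in> Hom a b \<Longrightarrow> comp m (ident b) = m"
    and comp_inver: "m \<in> Hom a b \<Longrightarrow> comp m (inver m) = ident a"
    and inver_comp: "m \<in> Hom a b \<Longrightarrow> comp (inver m) m = ident b"

end

theory Submission
  imports Defs "HOL.Modules"
begin

text \<open>
  Let \<open>s\<close> be a derivation over \<open>f0\<close> and \<open>s'\<close> one over \<open>f0 + d1 s\<close>.  Their sum is in general no derivation over
  \<open>f0\<close>, because the Peiffer expressions \<open>s' r' * s r - d1 (s r) \<cdot> s' r' = d2 \<lbrace>s' r', s r\<rbrace>\<close> need not vanish.
  The obstruction is a boundary, and the \<open>L'\<close>-component \<open>w\<close> of the 2-simplex map of \<open>s\<close> and \<open>s'\<close> fills it: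
  since the base algebra is free on \<open>B\<close>, there is exactly one linear \<open>w\<close> that vanishes on \<open>B\<close> (and on the
  identity, under the unital convention) and satisfies
    \<open>w (r r') = f0 r \<odot> w r' + f0 r' \<odot> w r + \<sigma> r \<rhd> w r' + \<sigma> r' \<rhd> w r - \<lbrace>s' r', s r\<rbrace> - \<lbrace>s' r, s r'\<rbrace> - w r w r'\<close>
  for \<open>\<sigma> = s + s'\<close>.  Existence holds because 2-simplices form a commutative algebra
  (\<open>simplex2\<close>, \<open>extension_exists\<close>, \<open>filler_simplexW\<close>), and uniqueness by induction over the generators
  (\<open>twisted_deriv_unique\<close>).  The map \<open>s + s' - d2 w\<close> is then a derivation over \<open>f0\<close> with value \<open>s b + s' b\<close> at
  \<open>b \<in> B\<close>, so it is the derivation of the concatenation (\<open>deriv_of_concat\<close>).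

  With this formula the groupoid laws come down to the product rule of \<open>w\<close>.  Given that \<open>(s, t)\<close> is
  quadratic over \<open>f\<close>, the pair \<open>(s', t')\<close> is quadratic over the target of \<open>(s, t)\<close> if and only if
  \<open>(s + s' - d2 w, t + t' + w \<circ> d1)\<close> is quadratic over \<open>f\<close> (\<open>concat_quadratic_iff\<close>).  From left to right
  this says that homotopies compose.  From right to left, with the zero pair on the right, it says that
  inverses are homotopies.  For associativity, the two sums of fillers that belong to the two bracketings
  of three homotopies satisfy the same product rule and therefore agree (\<open>filler_assoc\<close>).  Identities hold
  because the cross terms vanish if \<open>s\<close> or \<open>s'\<close> is zero, so \<open>w = 0\<close>; right inverses hold by construction, and
  left inverses follow formally from right inverses.
\<close>

section \<open>Commutative algebras with an explicit product\<close>

lemma is_identity_unique: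
  assumes "is_identity mul u" "is_identity mul v" "\<And>x y. mul x y = mul y x"
  shows "u = v"
  using assms unfolding is_identity_def by metis

text \<open>The product is a parameter and not the class operation, because the semidirect products
  below put twisted products on product types.\<close>

locale comm_algebra_on =
  fixes sc :: "'k::{comm_ring,comm_monoid_mult} \<Rightarrow> 'a::ab_group_add \<Rightarrow> 'a"
    and mul :: "'a \<Rightarrow> 'a \<Rightarrow> 'a"
  assumes sc_add: "sc c (x + y) = sc c x + sc c y"
    and add_sc: "sc (c + d) x = sc c x + sc d x"
    and sc_sc: "sc (c * d) x = sc c (sc d x)"
    and one_sc: "sc 1 x = x"
    and sc_mul: "sc c (mul x y) = mul (sc c x) y"
    and mul_comm: "mul x y = mul y x"
    and mul_assoc: "mul (mul x y) z = mul x (mul y z)"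
    and mul_add: "mul x (y + z) = mul x y + mul x z"
begin

lemma add_mul: "mul (x + y) z = mul x z + mul y z"
  by (metis mul_comm mul_add)

lemma mul_sc: "sc c (mul x y) = mul x (sc c y)"
  by (metis mul_comm sc_mul)

lemma mul_sc_sc: "mul (sc c x) (sc d y) = sc (c * d) (mul x y)"
  by (metis sc_sc sc_mul mul_sc)

lemma zero_sc: "sc 0 x = 0"
  using add_sc[of 0 0 x] by simp

lemma sc_zero: "sc c 0 = 0"
  using sc_add[of c 0 0] by simp

lemma sc_diff: "sc c (x - y) = sc c x - sc c y"
  using sc_add[of c "x - y" y] by simp

lemma sc_uminus: "sc c (- x) = - sc c x"
  using sc_diff[of c 0 x] by (simp add: sc_zero)

lemma zero_mul: "mul 0 x = 0"
  using add_mul[of 0 0 x] by simp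

lemma mul_zero: "mul x 0 = 0"
  using mul_add[of x 0 0] by simp

lemma mul_left_comm: "mul x (mul y z) = mul y (mul x z)"
  by (metis mul_comm mul_assoc)

end

lemma comm_algebra_on_times: "comm_alg sc \<Longrightarrow> comm_algebra_on sc (*)"
  unfolding comm_alg_def by unfold_locales (auto simp: algebra_simps)

locale algebra_action_on =
  R: comm_algebra_on sr mr + M: comm_algebra_on sm mm
  for sr :: "'k::{comm_ring,comm_monoid_mult} \<Rightarrow> 'r::ab_group_add \<Rightarrow> 'r" and mr
    and sm :: "'k \<Rightarrow> 'm::ab_group_add \<Rightarrow> 'm" and mm +
  fixes act :: "'r \<Rightarrow> 'm \<Rightarrow> 'm"
  assumes act_add: "act r (m + n) = act r m + act r n"
    and add_act: "act (r + r') m = act r m + act r' m"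
    and act_sc: "act r (sm c m) = sm c (act r m)"
    and sc_act: "act (sr c r) m = sm c (act r m)"
    and act_mul: "act r (mm m n) = mm (act r m) n"
    and act_act: "act (mr r r') m = act r (act r' m)"
begin

lemma act_mul_right: "act r (mm m n) = mm m (act r n)"
  by (metis act_mul M.mul_comm)

lemma act_left_comm: "act r (act r' m) = act r' (act r m)"
  by (metis act_act R.mul_comm)

text \<open>The twisted summands are symmetric in the two factors, and associativity is the statement that
  \<open>r r'\<close> acts as \<open>r\<close> after \<open>r'\<close> and that the action is linear over the product of \<open>M\<close>.\<close>

lemma semidirect_product:
  "comm_algebra_on (semi_scale sr sm) (semi_mult act mr mm)"
proof
  fix x y z :: "'r \<times> 'm"
  obtain r m where x: "x = (r, m)" by (cases x)
  obtain r' m' where y: "y = (r', m')" by (cases y)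
  obtain r'' m'' where z: "z = (r'', m'')" by (cases z)
  note expand = x y z semi_mult_def semi_scale_def
  fix c d
  show "semi_scale sr sm c (x + y) = semi_scale sr sm c x + semi_scale sr sm c y"
    by (simp add: expand R.sc_add M.sc_add)
  show "semi_scale sr sm (c + d) x = semi_scale sr sm c x + semi_scale sr sm d x"
    by (simp add: expand R.add_sc M.add_sc)
  show "semi_scale sr sm (c * d) x = semi_scale sr sm c (semi_scale sr sm d x)"
    by (simp add: expand R.sc_sc M.sc_sc)
  show "semi_scale sr sm 1 x = x"
    by (simp add: expand R.one_sc M.one_sc)
  show "semi_scale sr sm c (semi_mult act mr mm x y) =
      semi_mult act mr mm (semi_scale sr sm c x) y"
    by (simp add: expand R.sc_mul M.sc_add sc_act act_sc M.sc_mul)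
  show "semi_mult act mr mm x y = semi_mult act mr mm y x"
    by (simp add: expand R.mul_comm M.mul_comm add.commute)
  show "semi_mult act mr mm (semi_mult act mr mm x y) z =
      semi_mult act mr mm x (semi_mult act mr mm y z)"
    by (simp add: expand R.mul_assoc M.mul_assoc act_add M.mul_add M.add_mul act_act
        act_left_comm add_ac flip: act_mul act_mul_right)
  show "semi_mult act mr mm x (y + z) =
      semi_mult act mr mm x y + semi_mult act mr mm x z"
    by (simp add: expand R.mul_add M.mul_add act_add add_act algebra_simps)
qed

end

section \<open>Free commutative algebras\<close>

text \<open>The product of the values \<open>v b\<close> over a multiset of elements \<open>b\<close>, with \<open>u\<close> as the value of the
  empty product.  It is folded without an identity, as in \<^const>\<open>monomial\<close>, so that an algebra
  without identity is a possible target.\<close>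

definition mset_product :: "('a \<Rightarrow> 'a \<Rightarrow> 'a) \<Rightarrow> ('b \<Rightarrow> 'a) \<Rightarrow> 'a \<Rightarrow> 'b multiset \<Rightarrow> 'a" where
  "mset_product mul v u m =
     (case fold_mset (\<lambda>b p. Some (case p of None \<Rightarrow> v b | Some x \<Rightarrow> mul (v b) x)) None m of
        None \<Rightarrow> u
      | Some x \<Rightarrow> x)"

lemma monomial_eq_mset_product:
  "monomial m = mset_product (*) (\<lambda>b. b) (THE u. is_identity (*) u) m"
  unfolding monomial_def mset_product_def ..

context comm_algebra_on
begin

lemma fold_mset_product_add:
  "fold_mset (\<lambda>b p. Some (case p of None \<Rightarrow> v b | Some x \<Rightarrow> mul (v b) x)) None (add_mset b m) =
   Some (case fold_mset (\<lambda>b p. Some (case p of None \<Rightarrow> v b | Some x \<Rightarrow> mul (v b) x)) None m of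
           None \<Rightarrow> v b | Some x \<Rightarrow> mul (v b) x)"
proof -
  interpret comp_fun_commute "\<lambda>b p. Some (case p of None \<Rightarrow> v b | Some x \<Rightarrow> mul (v b) x)"
    by unfold_locales (auto simp: fun_eq_iff mul_comm mul_left_comm split: option.split)
  show ?thesis by simp
qed

lemma mset_product_empty: "mset_product mul v u {#} = u"
  by (simp add: mset_product_def)

lemma mset_product_single: "mset_product mul v u {#b#} = v b"
  unfolding mset_product_def fold_mset_product_add by simp

lemma mset_product_add_mset:
  assumes "m \<noteq> {#}"
  shows "mset_product mul v u (add_mset b m) = mul (v b) (mset_product mul v u m)"
proof -
  obtain c n where "m = add_mset c n"
    using assms by (cases m) auto
  then show ?thesis
    unfolding mset_product_def by (simp add: fold_mset_product_add)
qed

lemma mset_product_union: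
  assumes "unital \<longrightarrow> is_identity mul u" and "unital \<or> m \<noteq> {#}" and "unital \<or> n \<noteq> {#}"
  shows "mset_product mul v u (m + n) = mul (mset_product mul v u m) (mset_product mul v u n)"
proof (cases "m = {#} \<or> n = {#}")
  case True
  moreover have "is_identity mul u"
    using True assms by blast
  then have "mul u x = x" "mul x u = x" for x
    by (metis is_identity_def mul_comm)+
  ultimately show ?thesis
    by (auto simp: mset_product_empty)
next
  case False
  have "mset_product mul v u (m + n) = mul (mset_product mul v u m) (mset_product mul v u n)"
    if "m \<noteq> {#}" for m
    using that
  proof (induction m)
    case (add b m)
    then show ?case
      using False
      by (cases "m = {#}")
        (simp_all add: mset_product_single mset_product_add_mset mul_assoc)
  qed simp
  then show ?thesis using False by blast
qed

end

locale free_comm_algebra =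
  fixes unital :: bool
    and sc :: "'k::{comm_ring,comm_monoid_mult} \<Rightarrow> 'a::comm_ring \<Rightarrow> 'a"
    and B :: "'a set"
  assumes comm_alg: "comm_alg sc"
    and basis: "free_basis unital sc B"
    and identity_exists: "unital \<longrightarrow> (\<exists>u::'a. is_identity (*) u)"
begin

sublocale comm_algebra_on sc "(*)"
  by (rule comm_algebra_on_times[OF comm_alg])

definition unit :: 'a where
  "unit = (THE u. is_identity (*) u)"

lemma is_identity_iff_unit:
  assumes unital
  shows "is_identity (*) u \<longleftrightarrow> u = unit"
proof -
  have "\<exists>!u::'a. is_identity (*) u"
    using identity_exists assms is_identity_unique[of "(*)"] mult.commute by metis
  then show ?thesis
    unfolding unit_def by (metis (full_types) theI')
qed

definition admissible :: "'a multiset \<Rightarrow> bool" where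
  "admissible m \<longleftrightarrow> set_mset m \<subseteq> B \<and> (unital \<or> m \<noteq> {#})"

lemma monomial_eq: "monomial m = mset_product (*) (\<lambda>b. b) unit m"
  by (simp add: monomial_eq_mset_product unit_def)

lemma monomial_union:
  assumes "admissible m" "admissible n"
  shows "monomial (m + n) = monomial m * monomial n"
  using assms mset_product_union[of unital unit m n "\<lambda>b. b"] is_identity_iff_unit
  unfolding monomial_eq admissible_def by blast

definition polys :: "('a multiset \<Rightarrow>\<^sub>0 'k) set" where
  "polys = {p. \<forall>m\<in>Poly_Mapping.keys p. admissible m}"

definition poly_value :: "('a multiset \<Rightarrow>\<^sub>0 'k) \<Rightarrow> 'a" where
  "poly_value p = (\<Sum>m\<in>Poly_Mapping.keys p. sc (Poly_Mapping.lookup p m) (monomial m))"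

lemma bij_poly_value: "bij_betw poly_value polys UNIV"
  using basis unfolding free_basis_def poly_value_def polys_def admissible_def .

text \<open>Surjectivity of evaluation: every element is a finite sum of multiples of monomials.\<close>

lemma span_induct [case_names add monomial]:
  assumes add: "\<And>x y. P x \<Longrightarrow> P y \<Longrightarrow> P (x + y)"
    and monomial: "\<And>c m. admissible m \<Longrightarrow> P (sc c (monomial m))"
    and zero: "P 0"
  shows "P x"
proof -
  obtain p where p: "p \<in> polys" "poly_value p = x"
    using bij_poly_value by (metis UNIV_I bij_betw_def imageE)
  have "P (\<Sum>m\<in>K. sc (Poly_Mapping.lookup p m) (monomial m))"
    if "finite K" "K \<subseteq> Poly_Mapping.keys p" for K
    using that
  proof (induction K)
    case (insert m K)
    then have "P (sc (Poly_Mapping.lookup p m) (monomial m))"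
      using p by (intro monomial) (auto simp: polys_def)
    from add[OF this insert.IH] show ?case
      using insert by simp
  qed (simp add: zero)
  from this[of "Poly_Mapping.keys p"] show ?thesis
    using p by (simp add: poly_value_def)
qed

text \<open>Zero is a separate case because a free algebra without identity on the empty set is zero, and no
  other case reaches its element.\<close>

lemma generators_induct [case_names basis unit zero add scale mult]:
  assumes basis: "\<And>b. b \<in> B \<Longrightarrow> P b"
    and unit: "unital \<Longrightarrow> P unit"
    and zero: "P 0"
    and add: "\<And>x y. P x \<Longrightarrow> P y \<Longrightarrow> P (x + y)"
    and scale: "\<And>c x. P x \<Longrightarrow> P (sc c x)"
    and mult: "\<And>x y. P x \<Longrightarrow> P y \<Longrightarrow> P (x * y)"
  shows "P x"
proof -
  have "P (monomial m)" if "admissible m" for m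
    using that
  proof (induction m)
    case empty
    then show ?case by (simp add: monomial_eq mset_product_empty admissible_def unit)
  next
    case (add b m)
    then show ?case
      by (cases "m = {#}")
        (simp_all add: monomial_eq mset_product_single mset_product_add_mset admissible_def
          basis mult)
  qed
  then show ?thesis
    by (intro span_induct[of P x] add scale zero)
qed

text \<open>The extension takes the unique polynomial with a given value and evaluates it in the target.
  Uniqueness of the polynomial makes this additive, and by bilinearity multiplicativity
  only has to be checked on multiples of monomials, where it is multiplication of multiset products;
  the product of polynomials never enters.\<close>

lemma extension_exists:
  fixes sc' :: "'k \<Rightarrow> 'b::ab_group_add \<Rightarrow> 'b" and mul' v u
  assumes alg: "comm_algebra_on sc' mul'"
    and identity: "unital \<longrightarrow> is_identity mul' u"
  shows "\<exists>F. base_alg_map unital sc (*) sc' mul' F \<and> (\<forall>b\<in>B. F b = v b)"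
proof -
  interpret T: comm_algebra_on sc' mul' by (rule alg)
  define \<phi> where "\<phi> = mset_product mul' v u"
  define value' where
    "value' p = (\<Sum>m\<in>Poly_Mapping.keys p. sc' (Poly_Mapping.lookup p m) (\<phi> m))" for p
  define coeffs where "coeffs = the_inv_into polys poly_value"
  define F where "F x = value' (coeffs x)" for x
  have inj: "inj_on poly_value polys" and surj: "poly_value ` polys = UNIV"
    using bij_poly_value by (auto simp: bij_betw_def)
  have coeffs_in: "coeffs x \<in> polys" for x
    unfolding coeffs_def using the_inv_into_into[OF inj, of x polys] surj by simp
  have value_coeffs: "poly_value (coeffs x) = x" for x
    unfolding coeffs_def using f_the_inv_into_f[OF inj, of x] surj by simp
  have F_value: "F (poly_value p) = value' p" if "p \<in> polys" for p
    using that by (simp add: F_def coeffs_def the_inv_into_f_f[OF inj])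
  have add_polys: "p + q \<in> polys" if "p \<in> polys" "q \<in> polys" for p q
    using that keys_add[of p q] by (auto simp: polys_def)
  have value_add: "poly_value (p + q) = poly_value p + poly_value q" for p q
    unfolding poly_value_def
    by (rule setsum_keys_plus_distrib) (simp_all add: zero_sc add_sc)
  have value'_add: "value' (p + q) = value' p + value' q" for p q
    unfolding value'_def
    by (rule setsum_keys_plus_distrib) (simp_all add: T.zero_sc T.add_sc)
  have F_add: "F (x + y) = F x + F y" for x y
    using F_value[OF add_polys[OF coeffs_in coeffs_in], of x y]
    by (simp add: value_add value'_add value_coeffs) (simp add: F_def)
  then have F_zero: "F 0 = 0"
    by (metis add_cancel_right_right)
  have F_monomial: "F (sc c (monomial m)) = sc' c (\<phi> m)" if "admissible m" for c m
    using that F_value[of "Poly_Mapping.single m c"]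
    by (cases "c = 0")
      (simp_all add: polys_def poly_value_def value'_def zero_sc T.zero_sc F_zero)
  have \<phi>_union: "\<phi> (m + n) = mul' (\<phi> m) (\<phi> n)" if "admissible m" "admissible n" for m n
    using that T.mset_product_union[OF identity, of m n v] by (simp add: \<phi>_def admissible_def)
  have F_scale: "F (sc c x) = sc' c (F x)" for c x
    by (induction x rule: span_induct)
      (simp_all add: F_add F_zero F_monomial sc_add T.sc_add sc_zero T.sc_zero flip: sc_sc T.sc_sc)
  have F_monomials: "F (sc c (monomial m) * sc d (monomial n)) =
      mul' (F (sc c (monomial m))) (F (sc d (monomial n)))"
    if "admissible m" "admissible n" for c d m n
  proof -
    have "sc c (monomial m) * sc d (monomial n) = sc (c * d) (monomial (m + n))"
      using that by (simp add: monomial_union mul_sc_sc)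
    moreover have "admissible (m + n)"
      using that by (auto simp: admissible_def)
    ultimately show ?thesis
      using that by (simp add: F_monomial \<phi>_union T.mul_sc_sc)
  qed
  have F_mult: "F (x * y) = mul' (F x) (F y)" for x y
  proof (induction x rule: span_induct)
    case (monomial c m)
    then show ?case
      by (induction y rule: span_induct)
        (simp_all add: F_add F_zero F_monomials distrib_left T.mul_add T.mul_zero)
  qed (simp_all add: F_add F_zero distrib_right T.add_mul T.zero_mul)
  have "F b = v b" if "b \<in> B" for b
    using F_monomial[of "{#b#}" 1] that
    by (simp add: admissible_def \<phi>_def monomial_eq mset_product_single T.mset_product_single
        one_sc T.one_sc)
  moreover have F_unit: "F unit = u" if unital
  proof -
    have "admissible {#}"
      using that unfolding admissible_def by simp
    from F_monomial[OF this, of 1] show ?thesis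
      by (simp add: \<phi>_def monomial_eq mset_product_empty T.mset_product_empty one_sc T.one_sc)
  qed
  moreover have "is_identity mul' (F w)" if "unital" "is_identity (*) w" for w
    using that identity F_unit is_identity_iff_unit[of w] by metis
  ultimately show ?thesis
    unfolding base_alg_map_def alg_map_def klinear_def
    using F_add F_scale F_mult by blast
qed

lemma extension_unique:
  assumes alg: "comm_algebra_on sc' mul'"
    and F: "base_alg_map unital sc (*) sc' mul' F"
    and G: "base_alg_map unital sc (*) sc' mul' G"
    and agree: "\<And>b. b \<in> B \<Longrightarrow> F b = G b"
  shows "F = G"
proof
  interpret T: comm_algebra_on sc' mul' by (rule alg)
  note maps = F[unfolded base_alg_map_def alg_map_def klinear_def]
    G[unfolded base_alg_map_def alg_map_def klinear_def]
  fix x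
  show "F x = G x"
  proof (induction x rule: generators_induct)
    case unit
    then have "is_identity mul' (F unit)" "is_identity mul' (G unit)"
      using maps by (simp_all add: is_identity_iff_unit)
    then show ?case
      by (rule is_identity_unique) (rule T.mul_comm)
  next
    case zero
    have "F (sc 0 0) = G (sc 0 0)"
      using maps by (simp add: T.zero_sc)
    then show ?case by (simp add: zero_sc)
  qed (use agree maps in simp_all)
qed

end

section \<open>Calculus in a 2-crossed module\<close>

text \<open>The parameter \<open>A'\<close> is the target of the maps and homotopies, because all computations take place
  there and the short notation is reserved for it.\<close>

locale two_xmod =
  fixes unital :: bool
    and A' :: "('k::{comm_ring,comm_monoid_mult}, 'l::comm_ring, 'e::comm_ring, 'r::comm_ring) xmod2"
  assumes two_crossed_module: "two_crossed_module unital A'"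
begin

abbreviation "d1 \<equiv> bd1 A'"
abbreviation "d2 \<equiv> bd2 A'"
abbreviation act_E (infixr "\<cdot>" 75) where "r \<cdot> e \<equiv> actE A' r e"
abbreviation act_L (infixr "\<odot>" 75) where "r \<odot> l \<equiv> actL A' r l"
abbreviation act_P (infixr "\<rhd>" 75) where "e \<rhd> l \<equiv> actP A' e l"
abbreviation lift ("\<lbrace>_,/ _\<rbrace>") where "\<lbrace>e, e'\<rbrace> \<equiv> plift A' e e'"

lemmas crossed_axioms = two_crossed_module[unfolded two_crossed_module_def]

lemma comm_algs: "comm_alg (scL A')" "comm_alg (scE A')" "comm_alg (scR A')"
  using crossed_axioms by simp_all

sublocale L: comm_algebra_on "scL A'" "(*)"
  by (rule comm_algebra_on_times[OF comm_algs(1)])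

sublocale E: comm_algebra_on "scE A'" "(*)"
  by (rule comm_algebra_on_times[OF comm_algs(2)])

sublocale R: comm_algebra_on "scR A'" "(*)"
  by (rule comm_algebra_on_times[OF comm_algs(3)])

lemma boundary_alg_maps:
  "d2 (l + m) = d2 l + d2 m" "d2 (l * m) = d2 l * d2 m" "d2 (scL A' c l) = scE A' c (d2 l)"
  "d1 (e + e') = d1 e + d1 e'" "d1 (e * e') = d1 e * d1 e'" "d1 (scE A' c e) = scR A' c (d1 e)"
  using crossed_axioms by (simp_all add: alg_map_def klinear_def)

lemma actE_linear:
  "(r + r') \<cdot> e = r \<cdot> e + r' \<cdot> e" "r \<cdot> (e + e') = r \<cdot> e + r \<cdot> e'"
  "r \<cdot> scE A' c e = scE A' c (r \<cdot> e)" "scR A' c r \<cdot> e = scE A' c (r \<cdot> e)"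
  using crossed_axioms by (simp_all add: alg_action_def kbilinear_def klinear_def)

lemma actL_linear:
  "(r + r') \<odot> l = r \<odot> l + r' \<odot> l" "r \<odot> (l + m) = r \<odot> l + r \<odot> m"
  "r \<odot> scL A' c l = scL A' c (r \<odot> l)" "scR A' c r \<odot> l = scL A' c (r \<odot> l)"
  using crossed_axioms by (simp_all add: alg_action_def kbilinear_def klinear_def)

lemma lift_linear:
  "\<lbrace>x + y, e\<rbrace> = \<lbrace>x, e\<rbrace> + \<lbrace>y, e\<rbrace>" "\<lbrace>e, x + y\<rbrace> = \<lbrace>e, x\<rbrace> + \<lbrace>e, y\<rbrace>"
  "\<lbrace>scE A' c x, e\<rbrace> = scL A' c \<lbrace>x, e\<rbrace>" "\<lbrace>e, scE A' c x\<rbrace> = scL A' c \<lbrace>e, x\<rbrace>"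
  using crossed_axioms by (simp_all add: kbilinear_def klinear_def)

lemma actP_linear:
  "(e + e') \<rhd> l = e \<rhd> l + e' \<rhd> l" "e \<rhd> (l + m) = e \<rhd> l + e \<rhd> m"
  "e \<rhd> scL A' c l = scL A' c (e \<rhd> l)" "scE A' c e \<rhd> l = scL A' c (e \<rhd> l)"
  by (simp_all add: actP_def lift_linear boundary_alg_maps)

lemma additives:
  "additive d1" "additive d2"
  "additive (\<lambda>r. r \<cdot> e)" "additive ((\<cdot>) r)" "additive (\<lambda>r. r \<odot> l)" "additive ((\<odot>) r)"
  "additive (\<lambda>e. \<lbrace>e, e'\<rbrace>)" "additive (\<lambda>e. \<lbrace>e', e\<rbrace>)"
  "additive (\<lambda>e. e \<rhd> l)" "additive ((\<rhd>) e)"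
  by (unfold_locales; simp add: boundary_alg_maps actE_linear actL_linear lift_linear actP_linear)+

lemmas zeros = additives[THEN additive.zero]
lemmas uminuses = additives[THEN additive.minus]
lemmas diffs = additives[THEN additive.diff]

lemmas multilinear =
  boundary_alg_maps actE_linear actL_linear lift_linear actP_linear zeros uminuses diffs

lemma alg_actions: "alg_action (scR A') (scE A') (\<cdot>)" "alg_action (scR A') (scL A') (\<odot>)"
  using crossed_axioms by simp_all

lemma actE_module:
  "(r * r') \<cdot> e = r \<cdot> r' \<cdot> e" "r \<cdot> (e * e') = (r \<cdot> e) * e'" "r \<cdot> (e * e') = e * (r \<cdot> e')"
  using alg_actions(1) unfolding alg_action_def by metis+

lemma actL_module:
  "(r * r') \<odot> l = r \<odot> r' \<odot> l" "r \<odot> (l * m) = (r \<odot> l) * m" "r \<odot> (l * m) = l * (r \<odot> m)"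
  using alg_actions(2) unfolding alg_action_def by metis+

lemma act_left_comm: "r \<cdot> r' \<cdot> e = r' \<cdot> r \<cdot> e" "r \<odot> r' \<odot> l = r' \<odot> r \<odot> l"
  by (simp_all add: mult.commute flip: actE_module(1) actL_module(1))

lemma boundaries:
  "d1 (d2 l) = 0" "d1 (r \<cdot> e) = r * d1 e" "d2 (r \<odot> l) = r \<cdot> d2 l"
  "d2 \<lbrace>e, e'\<rbrace> = e * e' - d1 e' \<cdot> e"
  using crossed_axioms by simp_all

lemma identity_axiom:
  "unital \<longrightarrow> (\<exists>u. is_identity (*) u \<and> (\<forall>e. u \<cdot> e = e) \<and> (\<forall>l. u \<odot> l = l))"
  using crossed_axioms by (elim conjE)

lemma lift_mult: "\<lbrace>e, e' * e''\<rbrace> = \<lbrace>e * e', e''\<rbrace> + d1 e'' \<odot> \<lbrace>e, e'\<rbrace>"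
  using crossed_axioms by blast

text \<open>The product \<open>y * z\<close> in the second argument can be split off in either order.\<close>

lemma lift_exchange: "\<lbrace>x * y, z\<rbrace> + d1 z \<odot> \<lbrace>x, y\<rbrace> = \<lbrace>x * z, y\<rbrace> + d1 y \<odot> \<lbrace>x, z\<rbrace>"
  by (metis lift_mult mult.commute)

lemma lift_d2_left: "\<lbrace>d2 l, e\<rbrace> = e \<rhd> l - d1 e \<odot> l"
  using crossed_axioms by blast

lemma lift_d2_right: "\<lbrace>e, d2 l\<rbrace> = e \<rhd> l"
  by (simp add: actP_def)

lemma lift_act: "\<lbrace>r \<cdot> e, e'\<rbrace> = r \<odot> \<lbrace>e, e'\<rbrace>" "\<lbrace>e, r \<cdot> e'\<rbrace> = r \<odot> \<lbrace>e, e'\<rbrace>"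
proof -
  have "r \<odot> \<lbrace>e, e'\<rbrace> = \<lbrace>r \<cdot> e, e'\<rbrace>" "r \<odot> \<lbrace>e, e'\<rbrace> = \<lbrace>e, r \<cdot> e'\<rbrace>"
    using crossed_axioms by blast+
  then show "\<lbrace>r \<cdot> e, e'\<rbrace> = r \<odot> \<lbrace>e, e'\<rbrace>" "\<lbrace>e, r \<cdot> e'\<rbrace> = r \<odot> \<lbrace>e, e'\<rbrace>"
    by simp_all
qed

lemma d2_actP: "d2 (e \<rhd> l) = e * d2 l"
  by (simp add: actP_def boundaries zeros)

lemma actP_act: "(r \<cdot> e) \<rhd> l = r \<odot> (e \<rhd> l)" "e \<rhd> (r \<odot> l) = r \<odot> (e \<rhd> l)"
  by (simp_all add: actP_def boundaries lift_act)

lemma actP_module: "(e * e') \<rhd> l = e \<rhd> e' \<rhd> l"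
  using lift_mult[of e e' "d2 l"] by (simp add: boundaries zeros d2_actP flip: lift_d2_right)

lemma actP_d2: "d2 l \<rhd> m = l * m"
  unfolding actP_def using crossed_axioms by blast

lemma actP_mult: "e \<rhd> (l * m) = (e \<rhd> l) * m"
  using actP_module[of e "d2 l" m] actP_d2[of "e \<rhd> l" m] by (simp add: actP_d2 d2_actP)

lemma actP_left_comm: "e \<rhd> e' \<rhd> l = e' \<rhd> e \<rhd> l"
  by (simp add: mult.commute flip: actP_module)

text \<open>Multiplication by an element of \<open>L\<close> is the action of its boundary, and the boundary of a lifting is
  the Peiffer expression \<open>e * e' - d1 e' \<cdot> e\<close>.\<close>

lemma lift_times: "\<lbrace>e, e'\<rbrace> * l = e \<rhd> e' \<rhd> l - d1 e' \<odot> (e \<rhd> l)"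
  using actP_d2[of "\<lbrace>e, e'\<rbrace>" l] by (simp add: boundaries multilinear actP_module actP_act)

text \<open>The left side is \<open>\<lbrace>e, d2 \<lbrace>x, y\<rbrace>\<rbrace>\<close>.  Splitting the product \<open>x * y\<close> in \<open>d2 \<lbrace>x, y\<rbrace>\<close> yields a second term
  \<open>d1 y \<odot> \<lbrace>e, x\<rbrace>\<close>, which the other part of the boundary cancels.\<close>

lemma actP_lift: "e \<rhd> \<lbrace>x, y\<rbrace> = \<lbrace>e * x, y\<rbrace>"
  using lift_d2_right[of e "\<lbrace>x, y\<rbrace>"]
  by (simp add: boundaries multilinear lift_mult lift_act)

lemma actP_mult_right: "e \<rhd> (l * m) = l * (e \<rhd> m)"
  using actP_mult[of e m l] by (simp add: mult.commute)

lemma times_lift: "l * \<lbrace>e, e'\<rbrace> = e \<rhd> e' \<rhd> l - d1 e' \<odot> (e \<rhd> l)"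
  using lift_times[of e e' l] by (simp add: mult.commute)

text \<open>These equations expand an expression into a sum of terms with scalars from \<open>R\<close> outermost, then
  actions of \<open>E\<close>, then products or liftings.  In \<open>\<lbrace>e, e'\<rbrace>\<close> products move into the first argument.
  Identities between expressions become comparisons of summands.\<close>

lemmas normal_form =
  multilinear boundaries lift_mult lift_d2_left lift_d2_right lift_act d2_actP
  actP_act actP_module actP_d2 lift_times times_lift actP_lift
  actE_module(1) actL_module(1) act_left_comm actP_left_comm
  actE_module(2,3)[symmetric] actL_module(2,3)[symmetric] actP_mult[symmetric]
  actP_mult_right[symmetric]

sublocale ER: algebra_action_on "scR A'" "(*)" "scE A'" "(*)" "(\<cdot>)"
  by unfold_locales (simp_all add: multilinear actE_module)

sublocale LE: algebra_action_on "scE A'" "(*)" "scL A'" "(*)" "(\<rhd>)"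
  by unfold_locales (simp_all add: multilinear actP_module actP_mult)

text \<open>Compatibility with the product of pairs \<open>(e, l)\<close> uses that \<open>L\<close> acts on itself through \<open>d2\<close>;
  compatibility with the product of pairs \<open>(r, e)\<close> needs the two ways of splitting \<open>\<lbrace>a, e * e'\<rbrace>\<close> to agree.\<close>

sublocale simplex2: algebra_action_on
  "semi_scale (scR A') (scE A')" "semi_mult (\<cdot>) (*) (*)"
  "semi_scale (scE A') (scL A')" "semi_mult (\<rhd>) (*) (*)"
  "simplex2_act A'"
proof -
  interpret P: comm_algebra_on "semi_scale (scR A') (scE A')" "semi_mult (\<cdot>) (*) (*)"
    by (rule ER.semidirect_product)
  interpret Q: comm_algebra_on "semi_scale (scE A') (scL A')" "semi_mult (\<rhd>) (*) (*)"
    by (rule LE.semidirect_product)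
  show "algebra_action_on (semi_scale (scR A') (scE A')) (semi_mult (\<cdot>) (*) (*))
     (semi_scale (scE A') (scL A')) (semi_mult (\<rhd>) (*) (*)) (simplex2_act A')"
  proof (unfold_locales, goal_cases)
    case (1 x m n)
    then show ?case
      by (simp add: simplex2_act_def semi_mult_def semi_scale_def multilinear algebra_simps
          split: prod.splits)
  next
    case (2 x y m)
    then show ?case
      by (simp add: simplex2_act_def semi_mult_def semi_scale_def multilinear algebra_simps
          split: prod.splits)
  next
    case (3 x c m)
    then show ?case
      by (simp add: simplex2_act_def semi_mult_def semi_scale_def multilinear
          E.sc_add E.mul_sc L.sc_add L.sc_diff split: prod.splits)
  next
    case (4 c x m)
    then show ?case
      by (simp add: simplex2_act_def semi_mult_def semi_scale_def multilinear
          E.sc_add E.sc_mul L.sc_add L.sc_diff split: prod.splits)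
  next
    case (5 x m n)
    then show ?case
      by (cases x; cases m; cases n)
        (simp add: simplex2_act_def semi_mult_def normal_form algebra_simps)
  next
    case (6 x y m)
    obtain r e where x: "x = (r, e)" by (cases x)
    obtain r' e' where y: "y = (r', e')" by (cases y)
    obtain a l where m: "m = (a, l)" by (cases m)
    show ?case
      using lift_exchange[of a e e']
      by (simp add: x y m simplex2_act_def semi_mult_def normal_form algebra_simps)
  qed
qed

end

section \<open>Derivations out of a free algebra\<close>

lemma klinear_zero:
  assumes "klinear sa sb h"
  shows "h 0 = 0"
  using assms unfolding klinear_def by (metis add_cancel_right_right)

locale free_source = two_xmod unital A'
  for unital and A' :: "('k::{comm_ring,comm_monoid_mult}, 'l'::comm_ring, 'e'::comm_ring, 'r'::comm_ring) xmod2" +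
  fixes A :: "('k, 'l::comm_ring, 'e::comm_ring, 'r::comm_ring) xmod2"
    and B :: "'r set"
  assumes source: "two_crossed_module unital A"
    and free: "free_up_to_order_one unital A B"
begin

lemma source_boundary:
  "bd1 A (x + y) = bd1 A x + bd1 A y" "bd1 A (scE A c x) = scR A c (bd1 A x)"
  "bd1 A (x * y) = bd1 A x * bd1 A y" "bd1 A (actE A r x) = r * bd1 A x" "bd1 A (bd2 A l) = 0"
  using source by (simp_all add: two_crossed_module_def alg_map_def klinear_def)

sublocale S: free_comm_algebra unital "scR A" B
  using source free
  by unfold_locales (auto simp: two_crossed_module_def free_up_to_order_one_def)

abbreviation "base_map f0 \<equiv> base_alg_map unital (scR A) (*) (scR A') (*) f0"
abbreviation "deriv f0 s \<equiv> derivation unital A A' f0 s"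
abbreviation "deriv_of f0 v \<equiv> deriv_ext unital A A' B f0 v"
abbreviation "W f0 s s' \<equiv> simplexW unital A A' B f0 s s'"
abbreviation "shift f0 s \<equiv> \<lambda>r. f0 r + d1 (s r)"

lemma base_mapD:
  assumes "base_map f0"
  shows "f0 (x + y) = f0 x + f0 y" "f0 (scR A c x) = scR A' c (f0 x)" "f0 (x * y) = f0 x * f0 y"
    and "f0 0 = 0" "unital \<Longrightarrow> is_identity (*) (f0 S.unit)"
  using assms klinear_zero[of "scR A" "scR A'" f0]
  by (simp_all add: base_alg_map_def alg_map_def klinear_def S.is_identity_iff_unit)

lemma deriv_iff:
  "deriv f0 s \<longleftrightarrow> klinear (scR A) (scE A') s \<and>
     (\<forall>r r'. s (r * r') = f0 r \<cdot> s r' + f0 r' \<cdot> s r + s r * s r') \<and> (unital \<longrightarrow> s S.unit = 0)"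
  by (auto simp: derivation_def S.is_identity_iff_unit)

lemma derivD:
  assumes "deriv f0 s"
  shows "s (x + y) = s x + s y" "s (scR A c x) = scE A' c (s x)"
    and "s (x * y) = f0 x \<cdot> s y + f0 y \<cdot> s x + s x * s y"
    and "s 0 = 0" "unital \<Longrightarrow> s S.unit = 0"
  using assms[unfolded deriv_iff] klinear_zero[of "scR A" "scE A'" s]
  by (simp_all add: klinear_def)

lemma identity_acts:
  assumes "unital" "is_identity (*) u"
  shows "u \<cdot> e = e" "u \<odot> l = l"
proof -
  obtain v where v: "is_identity (*) v" "\<And>e. v \<cdot> e = e" "\<And>l. v \<odot> l = l"
    using identity_axiom assms(1) by metis
  have "u = v"
    using assms(2) v(1) by (rule is_identity_unique) (rule mult.commute)
  then show "u \<cdot> e = e" "u \<odot> l = l" using v by simp_all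
qed

lemma target_identity:
  assumes unital
  obtains u :: 'r' where "is_identity (*) u"
  using identity_axiom assms by metis

lemma deriv_unique:
  assumes "deriv f0 s" "deriv f0 s'" "\<And>b. b \<in> B \<Longrightarrow> s b = s' b"
  shows "s = s'"
proof
  fix r
  show "s r = s' r"
    by (induction r rule: S.generators_induct)
      (simp_all add: assms(3) derivD[OF assms(1)] derivD[OF assms(2)])
qed

lemma deriv_of_eqI:
  assumes "deriv f0 s" "\<And>b. b \<in> B \<Longrightarrow> s b = v b"
  shows "deriv_of f0 v = s"
  unfolding deriv_ext_def using assms deriv_unique[of f0] by (intro the_equality) auto

text \<open>A derivation over \<open>f0\<close> is the second component of an algebra map into the semidirect product of \<open>R'\<close>
  and \<open>E'\<close> with first component \<open>f0\<close>.  The universal property prescribes the first component on \<open>B\<close> only,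
  so uniqueness of extensions is used to identify it with \<open>f0\<close>.\<close>

lemma deriv_exists:
  assumes f0: "base_map f0"
  shows "\<exists>s. deriv f0 s \<and> (\<forall>b\<in>B. s b = v b)"
proof -
  obtain u :: 'r' where u: "unital \<longrightarrow> is_identity (*) u"
    using target_identity by metis
  have id: "unital \<longrightarrow> is_identity (semi_mult (\<cdot>) (*) (*)) (u, 0)"
    using u identity_acts[of u] by (auto simp: is_identity_def semi_mult_def multilinear)
  obtain X where X: "base_alg_map unital (scR A) (*) (semi_scale (scR A') (scE A')) (semi_mult (\<cdot>) (*) (*)) X"
    and XB: "\<And>b. b \<in> B \<Longrightarrow> X b = (f0 b, v b)"
    using S.extension_exists[OF ER.semidirect_product id, of "\<lambda>b. (f0 b, v b)"] by blast
  have Xmap: "X (r + r') = X r + X r'" "X (scR A c r) = semi_scale (scR A') (scE A') c (X r)"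
    "X (r * r') = semi_mult (\<cdot>) (*) (*) (X r) (X r')" for r r' c
    using X by (simp_all add: base_alg_map_def alg_map_def klinear_def)
  have Xunit: "X S.unit = (u, 0)" if unital
  proof (rule is_identity_unique)
    show "is_identity (semi_mult (\<cdot>) (*) (*)) (X S.unit)"
      using X that by (simp add: base_alg_map_def S.is_identity_iff_unit)
  qed (use id that simplex2.R.mul_comm in auto)
  have fst_map: "base_map (\<lambda>r. fst (X r))"
    using u by (auto simp: base_alg_map_def alg_map_def klinear_def Xmap Xunit
        S.is_identity_iff_unit semi_scale_def semi_mult_def split: prod.splits)
  have "(\<lambda>r. fst (X r)) = f0"
    by (rule S.extension_unique[OF R.comm_algebra_on_axioms fst_map f0]) (simp add: XB)
  then have fst: "fst (X r) = f0 r" for r by metis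
  have "deriv f0 (\<lambda>r. snd (X r))"
    by (auto simp: deriv_iff klinear_def Xmap Xunit semi_scale_def semi_mult_def
        case_prod_beta fst)
  then show ?thesis using XB by auto
qed

lemma deriv_of:
  assumes "base_map f0"
  shows "deriv f0 (deriv_of f0 v)" "b \<in> B \<Longrightarrow> deriv_of f0 v b = v b"
proof -
  obtain s where "deriv f0 s" "\<forall>b\<in>B. s b = v b"
    using deriv_exists[OF assms] by blast
  then show "deriv f0 (deriv_of f0 v)" "b \<in> B \<Longrightarrow> deriv_of f0 v b = v b"
    using deriv_of_eqI by auto
qed

section \<open>The 2-simplex map of two composable derivations\<close>

text \<open>The product rule for the \<open>L'\<close>-component of the 2-simplex map of \<open>s\<close> and \<open>s'\<close>, where \<open>\<sigma> = s + s'\<close> and the cross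
  term \<open>c\<close> consists of liftings of \<open>s'\<close> against \<open>s\<close>.  Keeping \<open>\<sigma>\<close> and \<open>c\<close> arbitrary lets the sum of two such
  components, as it occurs in a composite of three homotopies, satisfy a rule of the same form.\<close>

definition twisted_deriv ::
  "('r \<Rightarrow> 'r') \<Rightarrow> ('r \<Rightarrow> 'e') \<Rightarrow> ('r \<Rightarrow> 'r \<Rightarrow> 'l') \<Rightarrow> ('r \<Rightarrow> 'l') \<Rightarrow> bool" where
  "twisted_deriv f0 \<sigma> c w \<longleftrightarrow> klinear (scR A) (scL A') w \<and>
     (\<forall>r r'. w (r * r') = f0 r \<odot> w r' + f0 r' \<odot> w r + \<sigma> r \<rhd> w r' + \<sigma> r' \<rhd> w r
        - c r r' - w r * w r') \<and>
     (unital \<longrightarrow> w S.unit = 0) \<and> (\<forall>b\<in>B. w b = 0)"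

lemma twisted_derivD:
  assumes "twisted_deriv f0 \<sigma> c w"
  shows "w (x + y) = w x + w y" "w (scR A a x) = scL A' a (w x)"
    and "w (r * r') = f0 r \<odot> w r' + f0 r' \<odot> w r + \<sigma> r \<rhd> w r' + \<sigma> r' \<rhd> w r
        - c r r' - w r * w r'"
    and "w 0 = 0" "unital \<Longrightarrow> w S.unit = 0" "b \<in> B \<Longrightarrow> w b = 0"
  using assms[unfolded twisted_deriv_def] klinear_zero[of "scR A" "scL A'" w]
  by (simp_all add: klinear_def)

lemma twisted_deriv_unique:
  assumes "twisted_deriv f0 \<sigma> c w" "twisted_deriv f0 \<sigma> c w'"
  shows "w = w'"
proof
  fix r
  show "w r = w' r"
    by (induction r rule: S.generators_induct)
      (simp_all add: twisted_derivD[OF assms(1)] twisted_derivD[OF assms(2)])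
qed

text \<open>The 2-simplex map is \<open>((f0, s), (s' - d2 w, w))\<close>, not \<open>((f0, s), (s', w))\<close>: its third component \<open>v\<close>
  obeys a product rule with \<open>s r * v r'\<close> in place of \<open>d1 (s r) \<cdot> v r'\<close>, and the two differ by the Peiffer
  expression \<open>d2 \<lbrace>v r', s r\<rbrace>\<close>.  Eliminating the third component from the product rule of the fourth leaves the
  following condition on \<open>w\<close> alone, which determines \<open>w\<close>.\<close>

abbreviation filler where
  "filler f0 s s' w \<equiv> twisted_deriv f0 (\<lambda>r. s r + s' r) (\<lambda>r r'. \<lbrace>s' r', s r\<rbrace> + \<lbrace>s' r, s r'\<rbrace>) w"

lemma filler_simplexW:
  assumes f0: "base_map f0" and s: "deriv f0 s" and s': "deriv (shift f0 s) s'"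
  shows "filler f0 s s' (W f0 s s')"
proof -
  have alg: "comm_algebra_on (simplex2_scale A') (simplex2_mult A')"
    unfolding simplex2_scale_def simplex2_mult_def by (rule simplex2.semidirect_product)
  obtain u :: 'r' where u: "unital \<longrightarrow> is_identity (*) u"
    using target_identity by metis
  have id: "unital \<longrightarrow> is_identity (simplex2_mult A') ((u, 0), (0, 0))"
    using u identity_acts[of u]
    by (auto simp: is_identity_def simplex2_mult_def semi_mult_def simplex2_act_def multilinear
        zero_prod_def)
  let ?v = "\<lambda>b. ((f0 b, s b), (s' b, 0))"
  obtain X where X: "base_alg_map unital (scR A) (*) (simplex2_scale A') (simplex2_mult A') X"
    and XB: "\<And>b. b \<in> B \<Longrightarrow> X b = ?v b"
    using S.extension_exists[OF alg id, of ?v] by blast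
  have "simplexX unital A A' B f0 s s' = X"
    unfolding simplexX_def
    using X XB by (intro the_equality) (auto intro: S.extension_unique[OF alg])
  then have W: "W f0 s s' r = snd (snd (X r))" for r
    by (simp add: simplexW_def)
  have Xmap: "X (r + r') = X r + X r'" "X (scR A c r) = simplex2_scale A' c (X r)"
    "X (r * r') = simplex2_mult A' (X r) (X r')" for r r' c
    using X by (simp_all add: base_alg_map_def alg_map_def klinear_def)
  have Xunit: "X S.unit = ((u, 0), (0, 0))" if unital
  proof (rule is_identity_unique)
    show "is_identity (simplex2_mult A') (X S.unit)"
      using X that by (simp add: base_alg_map_def S.is_identity_iff_unit)
    show "simplex2_mult A' x y = simplex2_mult A' y x" for x y
      using alg by (rule comm_algebra_on.mul_comm)
  qed (use id that in auto)
  have X0: "X 0 = 0"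
    using Xmap(1)[of 0 0] by simp
  note products = simplex2_mult_def semi_mult_def simplex2_act_def
  note scales = simplex2_scale_def semi_scale_def
  have X_eq: "X r = ((f0 r, s r), (s' r - d2 (W f0 s s' r), W f0 s s' r))" for r
  proof -
    have "fst (fst (X r)) = f0 r \<and> snd (fst (X r)) = s r \<and>
        s' r = fst (snd (X r)) + d2 (snd (snd (X r)))"
    proof (induction r rule: S.generators_induct)
      case (basis b)
      then show ?case by (simp add: XB zeros)
    next
      case unit
      have "f0 S.unit = u"
      proof (rule is_identity_unique)
        show "is_identity (*) (f0 S.unit)" "is_identity (*) u"
          using base_mapD(5)[OF f0 unit] u unit by simp_all
      qed (rule mult.commute)
      then show ?case
        using unit derivD(5)[OF s] derivD(5)[OF s'] by (simp add: Xunit zeros)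
    next
      case zero
      then show ?case
        by (simp add: X0 zeros base_mapD[OF f0] derivD[OF s] derivD[OF s'])
    next
      case (add x y)
      then show ?case
        by (simp add: Xmap base_mapD[OF f0] derivD[OF s] derivD[OF s'] multilinear)
    next
      case (scale c x)
      then show ?case
        by (simp add: Xmap scales base_mapD[OF f0] derivD[OF s] derivD[OF s'] multilinear E.sc_add)
    next
      case (mult x y)
      then show ?case
        by (simp add: Xmap products base_mapD[OF f0] derivD[OF s] derivD[OF s'] case_prod_beta
            normal_form algebra_simps)
    qed
    then show ?thesis
      by (simp add: W prod_eq_iff)
  qed
  have mult: "W f0 s s' (r * r') = f0 r \<odot> W f0 s s' r' + f0 r' \<odot> W f0 s s' r
      + (s r + s' r) \<rhd> W f0 s s' r' + (s r' + s' r') \<rhd> W f0 s s' r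
      - (\<lbrace>s' r', s r\<rbrace> + \<lbrace>s' r, s r'\<rbrace>) - W f0 s s' r * W f0 s s' r'" for r r'
  proof -
    have "W f0 s s' (r * r') = snd (snd (simplex2_mult A' (X r) (X r')))"
      by (simp only: W Xmap)
    then show ?thesis
      by (simp add: X_eq products normal_form algebra_simps)
  qed
  have "W f0 s s' S.unit = 0" if unital
    by (simp only: W Xunit[OF that] snd_conv)
  then show ?thesis
    unfolding twisted_deriv_def
    by (auto simp: mult klinear_def) (auto simp: W Xmap XB scales)
qed

text \<open>The sum \<open>s + s'\<close> fails to be a derivation over \<open>f0\<close> exactly by Peiffer expressions; these are the
  boundaries of the cross terms in the product rule of \<open>w\<close>.\<close>

lemma concat_deriv:
  assumes s: "deriv f0 s" and s': "deriv (shift f0 s) s'" and w: "filler f0 s s' w"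
  shows "deriv f0 (\<lambda>r. s r + s' r - d2 (w r))"
  unfolding deriv_iff klinear_def
  by (auto simp: derivD[OF s] derivD[OF s'] twisted_derivD[OF w] normal_form E.sc_diff E.sc_add
      algebra_simps)

lemma deriv_of_concat:
  assumes s: "deriv f0 s" and s': "deriv (shift f0 s) s'" and w: "filler f0 s s' w"
  shows "deriv_of f0 (\<lambda>b. s b + s' b) = (\<lambda>r. s r + s' r - d2 (w r))"
  using concat_deriv[OF assms] by (rule deriv_of_eqI) (simp add: twisted_derivD(6)[OF w] zeros)

lemma filler_zero_left: "filler f0 (\<lambda>_. 0) s (\<lambda>_. 0)"
  by (simp add: twisted_deriv_def klinear_def multilinear L.sc_zero)

lemma filler_zero_right: "filler f0 s (\<lambda>_. 0) (\<lambda>_. 0)"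
  by (simp add: twisted_deriv_def klinear_def multilinear L.sc_zero)

text \<open>Both sides satisfy one product rule, in which the three derivations enter through their sum and
  through the liftings of each later one against each earlier one.\<close>

lemma filler_assoc:
  assumes w12: "filler f0 s1 s2 w12"
    and w12_3: "filler f0 (\<lambda>r. s1 r + s2 r - d2 (w12 r)) s3 w12_3"
    and w23: "filler (shift f0 s1) s2 s3 w23"
    and w1_23: "filler f0 s1 (\<lambda>r. s2 r + s3 r - d2 (w23 r)) w1_23"
  shows "w12 r + w12_3 r = w23 r + w1_23 r"
proof -
  let ?\<sigma> = "\<lambda>r. s1 r + s2 r + s3 r"
  let ?c = "\<lambda>r r'. \<lbrace>s2 r', s1 r\<rbrace> + \<lbrace>s2 r, s1 r'\<rbrace> + \<lbrace>s3 r', s1 r\<rbrace> + \<lbrace>s3 r, s1 r'\<rbrace>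
    + \<lbrace>s3 r', s2 r\<rbrace> + \<lbrace>s3 r, s2 r'\<rbrace>"
  have "twisted_deriv f0 ?\<sigma> ?c (\<lambda>r. w12 r + w12_3 r)"
    unfolding twisted_deriv_def klinear_def
    by (auto simp: twisted_derivD[OF w12] twisted_derivD[OF w12_3] normal_form L.sc_add
        algebra_simps)
  moreover have "twisted_deriv f0 ?\<sigma> ?c (\<lambda>r. w23 r + w1_23 r)"
    unfolding twisted_deriv_def klinear_def
    by (auto simp: twisted_derivD[OF w23] twisted_derivD[OF w1_23] normal_form L.sc_add
        algebra_simps)
  ultimately show ?thesis
    by (metis (no_types, lifting) twisted_deriv_unique)
qed

section \<open>Quadratic derivations under concatenation\<close>

abbreviation "xmap f \<equiv> xmod2_map unital A A' f"
abbreviation "qderiv f s t \<equiv> quadratic_derivation unital A A' f s t"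

lemma xmapD:
  assumes "xmap (f2, f1, f0)"
  shows "base_map f0" "f0 (bd1 A x) = d1 (f1 x)"
  using assms by (simp_all add: xmod2_map_def)

lemma qderivD:
  assumes "qderiv (f2, f1, f0) s t"
  shows "deriv f0 s" "klinear (scE A) (scL A') t"
    and "t (x * y) = \<lbrace>s (bd1 A x), f1 y\<rbrace> + \<lbrace>s (bd1 A y), f1 x\<rbrace> + f1 x \<rhd> t y + f1 y \<rhd> t x
        + s (bd1 A x) \<rhd> t y + s (bd1 A y) \<rhd> t x + t x * t y"
    and "t (actE A r x) = f0 r \<odot> t x + d1 (s r) \<odot> t x
        + \<lbrace>s r, f1 x\<rbrace> - \<lbrace>f1 x, s r\<rbrace> - \<lbrace>s (bd1 A x), s r\<rbrace>"
  using assms[unfolded quadratic_derivation_def prod.case] by simp_all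

text \<open>A quadratic derivation has prescribed values at products \<open>x * y\<close> and at \<open>r\<close> acting on \<open>x\<close>.  There the
  value prescribed for the composite exceeds the one prescribed for \<open>t'\<close> by exactly the value of
  \<open>t + w \<circ> d1\<close>, so the conditions on \<open>t'\<close> and on the composite are equivalent.  One direction gives
  composites; the other gives inverses, for which the composite is zero.\<close>

lemma concat_quadratic_iff:
  assumes f: "xmap (f2, f1, f0)" and q: "qderiv (f2, f1, f0) s t"
    and s': "deriv (shift f0 s) s'" and w: "filler f0 s s' w"
    and t': "klinear (scE A) (scL A') t'"
  shows "qderiv (target A A' ((f2, f1, f0), s, t)) s' t' \<longleftrightarrow>
    qderiv (f2, f1, f0) (\<lambda>r. s r + s' r - d2 (w r)) (\<lambda>e. t e + t' e + w (bd1 A e))"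
    (is "?L \<longleftrightarrow> ?R")
proof -
  let ?g1 = "\<lambda>x. f1 x + s (bd1 A x) + d2 (t x)"
  let ?s = "\<lambda>r. s r + s' r - d2 (w r)"
  let ?t = "\<lambda>x. t x + t' x + w (bd1 A x)"
  note rules = derivD[OF qderivD(1)[OF q]] qderivD(3,4)[OF q] derivD[OF s'] twisted_derivD[OF w]
    xmapD(2)[OF f] source_boundary
  let ?mult' = "\<lambda>x y. \<lbrace>s' (bd1 A x), ?g1 y\<rbrace> + \<lbrace>s' (bd1 A y), ?g1 x\<rbrace> + ?g1 x \<rhd> t' y + ?g1 y \<rhd> t' x
        + s' (bd1 A x) \<rhd> t' y + s' (bd1 A y) \<rhd> t' x + t' x * t' y"
  let ?mult = "\<lambda>x y. \<lbrace>?s (bd1 A x), f1 y\<rbrace> + \<lbrace>?s (bd1 A y), f1 x\<rbrace> + f1 x \<rhd> ?t y + f1 y \<rhd> ?t x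
        + ?s (bd1 A x) \<rhd> ?t y + ?s (bd1 A y) \<rhd> ?t x + ?t x * ?t y"
  let ?act' = "\<lambda>r x. shift f0 s r \<odot> t' x + d1 (s' r) \<odot> t' x
        + \<lbrace>s' r, ?g1 x\<rbrace> - \<lbrace>?g1 x, s' r\<rbrace> - \<lbrace>s' (bd1 A x), s' r\<rbrace>"
  let ?act = "\<lambda>r x. f0 r \<odot> ?t x + d1 (?s r) \<odot> ?t x
        + \<lbrace>?s r, f1 x\<rbrace> - \<lbrace>f1 x, ?s r\<rbrace> - \<lbrace>?s (bd1 A x), ?s r\<rbrace>"
  have mult: "?mult x y = ?t (x * y) - t' (x * y) + ?mult' x y" for x y
    by (simp add: rules normal_form algebra_simps)
  have act: "?act r x = ?t (actE A r x) - t' (actE A r x) + ?act' r x" for r x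
    by (simp add: rules normal_form algebra_simps)
  have lin: "klinear (scE A) (scL A') ?t"
    using qderivD(2)[OF q] t' twisted_derivD[OF w] source_boundary
    by (simp add: klinear_def L.sc_add algebra_simps)
  have "?L \<longleftrightarrow> (\<forall>x y. t' (x * y) = ?mult' x y) \<and> (\<forall>r x. t' (actE A r x) = ?act' r x)"
    unfolding quadratic_derivation_def target_def prod.case using s' t' by simp
  also have "\<dots> \<longleftrightarrow> (\<forall>x y. ?t (x * y) = ?mult x y) \<and> (\<forall>r x. ?t (actE A r x) = ?act r x)"
    unfolding mult act by (simp add: algebra_simps)
  also have "\<dots> \<longleftrightarrow> ?R"
    unfolding quadratic_derivation_def prod.case
    using concat_deriv[OF qderivD(1)[OF q] s' w] lin by simp
  finally show ?thesis .
qed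


lemma target_concat:
  "target A A' (target A A' ((f2, f1, f0), s, t), s', t') =
   target A A' ((f2, f1, f0), \<lambda>r. s r + s' r - d2 (w r), \<lambda>e. t e + t' e + w (bd1 A e))"
  if "w 0 = 0"
  using that
  by (auto simp: target_def fun_eq_iff multilinear boundaries source_boundary algebra_simps)

section \<open>The groupoid of maps and homotopies\<close>

abbreviation "Homs \<equiv> homotopies unital A A'"
abbreviation "cat \<equiv> hconcat unital A A' B"
abbreviation "inv_h \<equiv> hinverse unital A A' B"

lemma homsE:
  assumes "m \<in> Homs f g"
  obtains f2 f1 f0 s t where "f = (f2, f1, f0)" "m = ((f2, f1, f0), s, t)"
    "xmap (f2, f1, f0)" "xmap g" "qderiv (f2, f1, f0) s t" "g = target A A' ((f2, f1, f0), s, t)"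
    "base_map f0" "deriv f0 s" "base_map (shift f0 s)"
proof -
  obtain f2 f1 f0 where f: "f = (f2, f1, f0)" by (cases f)
  obtain s t where m: "m = (f, s, t)" "xmap f" "xmap g" "qderiv f s t" "g = target A A' (f, s, t)"
    using assms by (auto simp: homotopies_def)
  have "base_map (shift f0 s)"
    using m(3) unfolding m(5) f target_def prod.case by (rule xmapD)
  then show ?thesis
    using that[OF f] m qderivD(1)[of f2 f1 f0 s t] xmapD(1)[of f2 f1 f0] unfolding f by blast
qed

lemma homsI:
  "xmap f \<Longrightarrow> xmap g \<Longrightarrow> qderiv f s t \<Longrightarrow> g = target A A' (f, s, t) \<Longrightarrow> (f, s, t) \<in> Homs f g"
  by (auto simp: homotopies_def)

lemma concat_eq:
  assumes "base_map f0" "deriv f0 s" "deriv (shift f0 s) s'"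
  shows "cat ((f2, f1, f0), s, t) (g, s', t') =
    ((f2, f1, f0), \<lambda>r. s r + s' r - d2 (W f0 s s' r), \<lambda>e. t e + t' e + W f0 s s' (bd1 A e))"
  using deriv_of_concat[OF assms(2,3) filler_simplexW[OF assms]] by (simp add: hconcat_def)

lemma concat_in_homs:
  assumes m: "m \<in> Homs f g" and n: "n \<in> Homs g h"
  shows "cat m n \<in> Homs f h"
  using m
proof (cases rule: homsE)
  case m: (1 f2 f1 f0 s t)
  obtain s' t' where n: "n = (g, s', t')" "xmap h" "qderiv g s' t'" "h = target A A' (g, s', t')"
    using n by (auto simp: homotopies_def)
  have g: "g = (\<lambda>l. f2 l + t (bd2 A l), \<lambda>e. f1 e + s (bd1 A e) + d2 (t e), shift f0 s)"
    using m by (simp add: target_def)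
  have s': "deriv (shift f0 s) s'" and t': "klinear (scE A) (scL A') t'"
    using n(3) unfolding g by (rule qderivD)+
  note w = filler_simplexW[OF m(7,8) s']
  show ?thesis
    unfolding n(1) m(2) concat_eq[OF m(7,8) s'] unfolding m(1)
  proof (rule homsI)
    show "qderiv (f2, f1, f0) (\<lambda>r. s r + s' r - d2 (W f0 s s' r))
        (\<lambda>e. t e + t' e + W f0 s s' (bd1 A e))"
      using n(3) unfolding m(6) concat_quadratic_iff[OF m(3,5) s' w t'] .
    show "h = target A A' ((f2, f1, f0), \<lambda>r. s r + s' r - d2 (W f0 s s' r),
        \<lambda>e. t e + t' e + W f0 s s' (bd1 A e))"
      unfolding n(4) m(6) by (rule target_concat) (rule twisted_derivD(4)[OF w])
  qed (use m n in simp_all)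
qed

lemma deriv_zero: "deriv f0 (\<lambda>_. 0)"
  by (simp add: deriv_iff klinear_def multilinear E.sc_zero)

lemma qderiv_zero: "qderiv f (\<lambda>_. 0) (\<lambda>_. 0)"
  by (cases f) (simp add: quadratic_derivation_def deriv_zero klinear_def multilinear L.sc_zero)

lemma target_zero: "target A A' (f, \<lambda>_. 0, \<lambda>_. 0) = f"
  by (cases f) (simp add: target_def multilinear)

lemma ident_in_homs: "xmap f \<Longrightarrow> hident f \<in> Homs f f"
  unfolding hident_def by (intro homsI qderiv_zero) (simp_all add: target_zero)

lemma concat_assoc:
  assumes m: "m \<in> Homs f g" and n: "n \<in> Homs g h" and p: "p \<in> Homs h k"
  shows "cat (cat m n) p = cat m (cat n p)"
  using m
proof (cases rule: homsE)
  case m: (1 f2 f1 f0 s t)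
  have g: "g = (\<lambda>l. f2 l + t (bd2 A l), \<lambda>e. f1 e + s (bd1 A e) + d2 (t e), shift f0 s)"
    using m by (simp add: target_def)
  obtain s' t' where n': "n = (g, s', t')" "xmap h" "qderiv g s' t'" "h = target A A' (g, s', t')"
    using n by (auto simp: homotopies_def)
  obtain s'' t'' where p': "p = (h, s'', t'')" "qderiv h s'' t''"
    using p by (auto simp: homotopies_def)
  have s': "deriv (shift f0 s) s'"
    using n'(3) unfolding g by (rule qderivD)
  have s'': "deriv (shift (shift f0 s) s') s''"
    using p'(2) unfolding n'(4) g target_def prod.case by (rule qderivD)
  let ?w12 = "W f0 s s'" and ?w23 = "W (shift f0 s) s' s''"
  let ?s12 = "\<lambda>r. s r + s' r - d2 (?w12 r)" and ?s23 = "\<lambda>r. s' r + s'' r - d2 (?w23 r)"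
  note w12 = filler_simplexW[OF m(7,8) s']
  note w23 = filler_simplexW[OF m(9) s' s'']
  have s12: "deriv f0 ?s12" and s23: "deriv (shift f0 s) ?s23"
    using concat_deriv[OF m(8) s' w12] concat_deriv[OF s' s'' w23] .
  have "shift f0 ?s12 = shift (shift f0 s) s'"
    by (simp add: multilinear boundaries add.assoc)
  with s'' have s3: "deriv (shift f0 ?s12) s''" by simp
  note w12_3 = filler_simplexW[OF m(7) s12 s3]
  note w1_23 = filler_simplexW[OF m(7,8) s23]
  have assoc: "?w12 r + W f0 ?s12 s'' r = ?w23 r + W f0 s ?s23 r" for r
    by (rule filler_assoc[OF w12 w12_3 w23 w1_23])
  have assoc_d2: "d2 (?w12 r) + d2 (W f0 ?s12 s'' r) = d2 (?w23 r) + d2 (W f0 s ?s23 r)" for r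
    using arg_cong[OF assoc[of r], of d2] by (simp only: boundary_alg_maps)
  have left: "cat (cat m n) p = ((f2, f1, f0), \<lambda>r. ?s12 r + s'' r - d2 (W f0 ?s12 s'' r),
      \<lambda>e. t e + t' e + ?w12 (bd1 A e) + t'' e + W f0 ?s12 s'' (bd1 A e))"
    unfolding m(2) n'(1) p'(1) concat_eq[OF m(7,8) s'] concat_eq[OF m(7) s12 s3] ..
  have right: "cat m (cat n p) = ((f2, f1, f0), \<lambda>r. s r + ?s23 r - d2 (W f0 s ?s23 r),
      \<lambda>e. t e + (t' e + t'' e + ?w23 (bd1 A e)) + W f0 s ?s23 (bd1 A e))"
    unfolding m(2) n'(1) p'(1) g concat_eq[OF m(9) s' s''] concat_eq[OF m(7,8) s23] ..
  have "?s12 r + s'' r - d2 (W f0 ?s12 s'' r) = s r + ?s23 r - d2 (W f0 s ?s23 r)" for r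
    using assoc_d2[of r] by (simp add: algebra_simps)
  moreover have "t e + t' e + ?w12 (bd1 A e) + t'' e + W f0 ?s12 s'' (bd1 A e) =
      t e + (t' e + t'' e + ?w23 (bd1 A e)) + W f0 s ?s23 (bd1 A e)" for e
    using assoc[of "bd1 A e"] by (simp add: algebra_simps)
  ultimately show ?thesis
    unfolding left right by (simp only:)
qed

lemma ident_concat:
  assumes m: "m \<in> Homs f g"
  shows "cat (hident f) m = m"
  using m
proof (cases rule: homsE)
  case (1 f2 f1 f0 s t)
  have s: "deriv (shift f0 (\<lambda>_. 0)) s"
    using 1(8) by (simp add: zeros)
  have "W f0 (\<lambda>_. 0) s = (\<lambda>_. 0)"
    using filler_simplexW[OF 1(7) deriv_zero s] filler_zero_left by (rule twisted_deriv_unique)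
  then show ?thesis
    unfolding 1(1,2) hident_def concat_eq[OF 1(7) deriv_zero s] by (simp add: zeros)
qed

lemma concat_ident:
  assumes m: "m \<in> Homs f g"
  shows "cat m (hident g) = m"
  using m
proof (cases rule: homsE)
  case (1 f2 f1 f0 s t)
  have "W f0 s (\<lambda>_. 0) = (\<lambda>_. 0)"
    using filler_simplexW[OF 1(7,8) deriv_zero] filler_zero_right by (rule twisted_deriv_unique)
  then show ?thesis
    unfolding 1(2) hident_def concat_eq[OF 1(7,8) deriv_zero] by (simp add: zeros)
qed

text \<open>The composite with the inverse has derivation zero because it vanishes on \<open>B\<close>, and second component
  zero by the choice of \<open>t'\<close>.  Since the zero pair is a quadratic derivation over \<open>f\<close>, the inverse is one
  over \<open>g\<close>.\<close>

lemma concat_inverse: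
  assumes m: "m \<in> Homs f g"
  shows "inv_h m \<in> Homs g f" and "cat m (inv_h m) = hident f"
proof -
  obtain f2 f1 f0 s t where f: "f = (f2, f1, f0)" and m': "m = ((f2, f1, f0), s, t)"
    and xmaps: "xmap (f2, f1, f0)" "xmap g" and q: "qderiv (f2, f1, f0) s t"
    and g: "g = target A A' ((f2, f1, f0), s, t)"
    and base: "base_map f0" "deriv f0 s" "base_map (shift f0 s)"
    using m by (rule homsE)
  define s' where "s' = deriv_of (shift f0 s) (\<lambda>b. - s b)"
  define t' where "t' = (\<lambda>e. - t e - W f0 s s' (bd1 A e))"
  have s': "deriv (shift f0 s) s'" "\<And>b. b \<in> B \<Longrightarrow> s' b = - s b"
    using deriv_of[OF base(3)] by (simp_all add: s'_def)
  have inv: "inv_h m = (g, s', t')"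
    by (simp add: m' hinverse_def g target_def s'_def t'_def Let_def)
  note w = filler_simplexW[OF base(1,2) s'(1)]
  have "deriv_of f0 (\<lambda>b. s b + s' b) = (\<lambda>_. 0)"
    by (rule deriv_of_eqI[OF deriv_zero]) (simp add: s'(2))
  then have s0: "(\<lambda>r. s r + s' r - d2 (W f0 s s' r)) = (\<lambda>_. 0)"
    using deriv_of_concat[OF base(2) s'(1) w] by simp
  have t0: "(\<lambda>e. t e + t' e + W f0 s s' (bd1 A e)) = (\<lambda>_. 0)"
    by (simp add: t'_def)
  show "cat m (inv_h m) = hident f"
    unfolding inv unfolding m' concat_eq[OF base(1,2) s'(1)] s0 t0 f hident_def ..
  have t': "klinear (scE A) (scL A') t'"
    using qderivD(2)[OF q] unfolding klinear_def t'_def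
    by (simp add: source_boundary twisted_derivD[OF w] L.sc_diff L.sc_uminus algebra_simps)
  show "inv_h m \<in> Homs g f"
    unfolding inv
  proof (rule homsI)
    show "qderiv g s' t'"
      unfolding g concat_quadratic_iff[OF xmaps(1) q s'(1) w t'] s0 t0 by (rule qderiv_zero)
    show "f = target A A' (g, s', t')"
      unfolding g target_concat[where w = "W f0 s s'", OF twisted_derivD(4)[OF w]] s0 t0 target_zero f ..
  qed (use xmaps f in simp_all)
qed

text \<open>As in a monoid in which every element has a right inverse, the inverse of the inverse is \<open>m\<close>.\<close>

lemma inverse_concat:
  assumes m: "m \<in> Homs f g"
  shows "cat (inv_h m) m = hident g"
proof -
  let ?n = "inv_h m" and ?p = "inv_h (inv_h m)"
  note n = concat_inverse[OF m]
  note p = concat_inverse[OF n(1)]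
  have "m = cat m (cat ?n ?p)"
    unfolding p(2) by (rule concat_ident[OF m, symmetric])
  also have "\<dots> = cat (cat m ?n) ?p"
    by (rule concat_assoc[OF m n(1) p(1), symmetric])
  also have "\<dots> = ?p"
    unfolding n(2) by (rule ident_concat[OF p(1)])
  finally show ?thesis
    using p(2) by simp
qed

end

theorem theorem4p24:
  fixes A :: "('k::{comm_ring,comm_monoid_mult}, 'l::comm_ring, 'e::comm_ring, 'r::comm_ring) xmod2"
    and A' :: "('k, 'l'::comm_ring, 'e'::comm_ring, 'r'::comm_ring) xmod2"
    and B :: "'r set"
    and unital :: bool
  assumes "two_crossed_module unital A"
    and "two_crossed_module unital A'"
    and "free_up_to_order_one unital A B"
  shows "groupoid {f. xmod2_map unital A A' f} (homotopies unital A A')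
           (hconcat unital A A' B) hident (hinverse unital A A' B)"
proof -
  interpret free_source unital A' A B
    using assms by unfold_locales
  show ?thesis
  proof (unfold_locales, goal_cases)
    case (1 m f g)
    then show ?case by (auto simp: homotopies_def)
  next
    case (2 m f g f' g')
    then show ?case by (auto simp: homotopies_def)
  next
    case (3 m f g n h)
    then show ?case by (rule concat_in_homs)
  next
    case (4 f)
    then show ?case by (simp add: ident_in_homs)
  next
    case (5 m f g)
    then show ?case by (rule concat_inverse)
  next
    case (6 m f g n h p k)
    then show ?case by (rule concat_assoc)
  next
    case (7 m f g)
    then show ?case by (rule ident_concat)
  next
    case (8 m f g)
    then show ?case by (rule concat_ident)
  next
    case (9 m f g)
    then show ?case by (rule concat_inverse)
  next
    case (10 m f g)
    then show ?case by (rule inverse_concat)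
  qed
qed

end
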